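(* Let $[X,\mathcal B,m,\nu]$ be a reversible random walk space and for each $x$ let $A_x\subset\mathrm{supp}(m_x)$ be measurable (as in the context). For $u,v\in L^2(X,\nu)$, $(u,v)\in\partial_{L^2(X,\nu)}\mathcal F_{A,1,m}(u)$ if and only if there exists an antisymmetric $\mathbf g\in L^\infty(X\times X,\nu\otimes m_x)$ with $\|\mathbf g\|_{L^\infty(X\times X,\nu\otimes m_x)}\le1$ such that $$v(x)=-\int_X\mathbf g(x,y)K_A(x,y)\,dm_x(y)\quad\text{for }\nu\text{-a.e. }x\in X,$$ and $$\mathbf g(x,y)K_A(x,y)\in\mathrm{sign}(u(y)-u(x))\,K_A(x,y)\quad\text{for }(\nu\otimes m_x)\text{-a.e. }(x,y)\in X\times X.$$
   Context: A random walk space $[X,\mathcal B,m,\nu]$: measurable space with countably generated $\sigma$-algebra, probability measures $m_x$ with $x\mapsto m_x(B)$ measurable, $\sigma$-finite invariant $\nu$ ($\nu(A)=\int m_x(A)\,d\nu(x)$); reversible: $dm_x(y)d\nu(x)=dm_y(x)d\nu(y)$. $\nu\otimes m_x$ is the measure $dm_x(y)d\nu(x)$ on $X\times X$. $\nabla u(x,y)=u(y)-u(x)$. The set $\{(x,y):y\in A_x\}$ is assumed measurable and $K_A(x,y)=\frac12(\chi_{A_x}(y)+\chi_{A_y}(x))$. $\mathcal F_{A,1,m}(u)=\frac12\int_{X\times X}|\nabla u|K_A\,d(\nu\otimes m_x)$ on $L^2(X,\nu)$, $+\infty$ if infinite. $\mathrm{sign}(r)=\{1\}$ for $r>0$, $\{-1\}$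 for $r<0$, $[-1,1]$ for $r=0$. $\mathbf g$ antisymmetric means $\mathbf g(x,y)=-\mathbf g(y,x)$. $\partial$ denotes the convex subdifferential. *)

theory Defs
  imports "HOL-Probability.Probability"
begin

definition countably_generated :: "'a measure \<Rightarrow> bool" where
  "countably_generated M \<longleftrightarrow>
     (\<exists>G. countable G \<and> G \<subseteq> Pow (space M) \<and> sets M = sigma_sets (space M) G)"

definition rw_prod :: "'a measure \<Rightarrow> ('a \<Rightarrow> 'a measure) \<Rightarrow> ('a \<times> 'a) measure" where
  "rw_prod \<nu> m = measure_of (space \<nu> \<times> space \<nu>) (sets (\<nu> \<Otimes>\<^sub>M \<nu>))
     (\<lambda>C. \<integral>\<^sup>+ x. emeasure (m x) {y. (x, y) \<in> C} \<partial>\<nu>)"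

definition random_walk_space :: "'a measure \<Rightarrow> ('a \<Rightarrow> 'a measure) \<Rightarrow> bool" where
  "random_walk_space \<nu> m \<longleftrightarrow>
     countably_generated \<nu> \<and>
     m \<in> measurable \<nu> (prob_algebra \<nu>) \<and>
     sigma_finite_measure \<nu> \<and>
     (\<forall>A \<in> sets \<nu>. emeasure \<nu> A = (\<integral>\<^sup>+ x. emeasure (m x) A \<partial>\<nu>))"

definition reversible :: "'a measure \<Rightarrow> ('a \<Rightarrow> 'a measure) \<Rightarrow> bool" where
  "reversible \<nu> m \<longleftrightarrow>
     (\<forall>C \<in> sets (\<nu> \<Otimes>\<^sub>M \<nu>).
        (\<integral>\<^sup>+ x. emeasure (m x) {y. (x, y) \<in> C} \<partial>\<nu>) =
        (\<integral>\<^sup>+ x. emeasure (m x) {y. (y, x) \<in> C} \<partial>\<nu>))"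

definition K_A :: "('a \<Rightarrow> 'a set) \<Rightarrow> 'a \<Rightarrow> 'a \<Rightarrow> real" where
  "K_A A x y = (indicator (A x) y + indicator (A y) x) / 2"

definition F_A1m :: "('a \<Rightarrow> 'a set) \<Rightarrow> 'a measure \<Rightarrow> ('a \<Rightarrow> 'a measure) \<Rightarrow> ('a \<Rightarrow> real) \<Rightarrow> ennreal" where
  "F_A1m A \<nu> m u = ennreal (1/2) *
     (\<integral>\<^sup>+ z. ennreal (\<bar>u (snd z) - u (fst z)\<bar> * K_A A (fst z) (snd z)) \<partial>(rw_prod \<nu> m))"

definition L2 :: "'a measure \<Rightarrow> ('a \<Rightarrow> real) \<Rightarrow> bool" where
  "L2 \<nu> f \<longleftrightarrow> f \<in> borel_measurable \<nu> \<and> integrable \<nu> (\<lambda>x. (f x)\<^sup>2)"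

definition subdiff_L2 :: "'a measure \<Rightarrow> (('a \<Rightarrow> real) \<Rightarrow> ennreal) \<Rightarrow> ('a \<Rightarrow> real) \<Rightarrow> ('a \<Rightarrow> real) set" where
  "subdiff_L2 \<nu> F u = {v. L2 \<nu> v \<and> F u < \<infinity> \<and>
     (\<forall>w. L2 \<nu> w \<longrightarrow>
        enn2ereal (F u) + ereal (\<integral> x. v x * (w x - u x) \<partial>\<nu>) \<le> enn2ereal (F w))}"

definition sign_set :: "real \<Rightarrow> real set" where
  "sign_set r = (if r > 0 then {1} else if r < 0 then {-1} else {-1..1})"

end

theory Submission
  imports Defs
begin

text \<open>
  Write \<open>K\<close> for the kernel \<open>K_A\<close> and \<open>\<mu>\<close> for the measure \<open>dm_x(y) d\<nu>(x)\<close>, which is invariant under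
  \<open>(x, y) \<mapsto> (y, x)\<close>. For antisymmetric bounded \<open>g\<close> and \<open>w \<in> L\<^sup>1\<close> this symmetry gives
  \<open>\<integral> g \<nabla>w K d\<mu> = - 2 \<integral> w(x) (\<integral> g(x,y) K(x,y) dm_x(y)) d\<nu>(x)\<close>; it extends to
  \<open>w \<in> L\<^sup>2\<close> of finite energy by soft thresholding, which maps \<open>L\<^sup>2\<close> to \<open>L\<^sup>1 \<inter> L\<^sup>2\<close>, decreases \<open>|\<nabla>w|\<close>
  and preserves its sign.

  If \<open>g\<close> satisfies the two conditions, then \<open>\<integral> v w \<le> F(w)\<close> for all \<open>w\<close>, with equality at \<open>u\<close>
  (finiteness of \<open>F(u)\<close> being a consequence of Fatou's lemma), so \<open>v\<close> is a subgradient.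

  Conversely, a subgradient satisfies \<open>\<integral> v w \<le> F(w)\<close> and \<open>F(u) \<le> \<integral> v u\<close>. By the first
  inequality and the Hahn-Banach theorem, \<open>\<nabla>w \<mapsto> \<integral> v w\<close> extends to a functional on
  \<open>L\<^sup>1(K \<mu>)\<close> of norm at most \<open>1/2\<close>. It is represented by some \<open>g/2\<close> with \<open>|g| \<le> 1\<close>, which may be
  antisymmetrised; the second inequality then forces \<open>g \<nabla>u = |\<nabla>u|\<close> wherever \<open>K > 0\<close>.
\<close>

section \<open>The Hahn-Banach theorem for spaces of real functions\<close>

text \<open>Homogeneity is asked only as an inequality for positive factors, the form checked most
  directly for infima. On a subspace, equality and the value 0 at the zero function follow.\<close>

definition sublinear_on :: "('b \<Rightarrow> real) set \<Rightarrow> (('b \<Rightarrow> real) \<Rightarrow> real) \<Rightarrow> bool" where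
  "sublinear_on E q \<longleftrightarrow>
     (\<forall>f\<in>E. \<forall>g\<in>E. q (\<lambda>x. f x + g x) \<le> q f + q g) \<and>
     (\<forall>f\<in>E. \<forall>c>0. q (\<lambda>x. c * f x) \<le> c * q f)"

lemma sublinear_onD:
  assumes "sublinear_on E q" "f \<in> E"
  shows "g \<in> E \<Longrightarrow> q (\<lambda>x. f x + g x) \<le> q f + q g"
    and "c > 0 \<Longrightarrow> q (\<lambda>x. c * f x) \<le> c * q f"
  using assms unfolding sublinear_on_def by blast+

text \<open>Subadditivity survives the infimum because an index \<open>i\<close> good for
  \<open>f\<close> and an index \<open>j\<close> good for \<open>g\<close> can be merged into one
  index \<open>k\<close> for the sum. Three families below are of this kind: a chain, the shifts
  along a ray, and the shifts by a graph.\<close>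

lemma sublinear_on_INF:
  fixes r :: "'i \<Rightarrow> ('b \<Rightarrow> real) \<Rightarrow> real"
  assumes ne: "J \<noteq> {}"
    and add_closed: "\<And>f g. f \<in> E \<Longrightarrow> g \<in> E \<Longrightarrow> (\<lambda>x. f x + g x) \<in> E"
    and scale_closed: "\<And>f c. f \<in> E \<Longrightarrow> (\<lambda>x. c * f x) \<in> E"
    and bdd: "\<And>f. f \<in> E \<Longrightarrow> bdd_below ((\<lambda>j. r j f) ` J)"
    and add: "\<And>f g i j. f \<in> E \<Longrightarrow> g \<in> E \<Longrightarrow> i \<in> J \<Longrightarrow> j \<in> J \<Longrightarrow>
                \<exists>k\<in>J. r k (\<lambda>x. f x + g x) \<le> r i f + r j g"
    and scale: "\<And>f c j. f \<in> E \<Longrightarrow> c > 0 \<Longrightarrow> j \<in> J \<Longrightarrow> \<exists>k\<in>J. r k (\<lambda>x. c * f x) \<le> c * r j f"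
  shows "sublinear_on E (\<lambda>f. INF j\<in>J. r j f)"
  unfolding sublinear_on_def
proof (intro conjI ballI allI impI)
  fix f g assume f: "f \<in> E" and g: "g \<in> E"
  let ?I = "INF j\<in>J. r j (\<lambda>x. f x + g x)"
  have *: "?I \<le> r i f + r j g" if "i \<in> J" "j \<in> J" for i j
    using add[OF f g that] bdd[OF add_closed[OF f g]] by (meson cINF_lower2)
  have "?I - r j g \<le> (INF j\<in>J. r j f)" if "j \<in> J" for j
    using * that by (intro cINF_greatest[OF ne]) (simp add: diff_le_eq)
  then have "?I - (INF j\<in>J. r j f) \<le> (INF j\<in>J. r j g)"
    by (intro cINF_greatest[OF ne]) (simp add: algebra_simps)
  then show "?I \<le> (INF j\<in>J. r j f) + (INF j\<in>J. r j g)" by simp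
next
  fix f and c :: real assume f: "f \<in> E" and c: "0 < c"
  let ?I = "INF j\<in>J. r j (\<lambda>x. c * f x)"
  have "?I \<le> c * r j f" if "j \<in> J" for j
    using scale[OF f c that] bdd[OF scale_closed[OF f]] by (meson cINF_lower2)
  then have "?I / c \<le> (INF j\<in>J. r j f)"
    using c by (intro cINF_greatest[OF ne]) (simp add: field_simps)
  then show "?I \<le> c * (INF j\<in>J. r j f)" using c by (simp add: field_simps)
qed

text \<open>Elements are functions rather than classes modulo null sets, so that
  \<open>L\<^sup>1\<close> enters simply as the set of integrable functions.\<close>

locale function_subspace =
  fixes E :: "('b \<Rightarrow> real) set"
  assumes add_closed: "f \<in> E \<Longrightarrow> g \<in> E \<Longrightarrow> (\<lambda>x. f x + g x) \<in> E"
    and scale_closed: "f \<in> E \<Longrightarrow> (\<lambda>x. c * f x) \<in> E"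
    and zero_closed: "(\<lambda>x. 0) \<in> E"
begin

lemma uminus_closed: "f \<in> E \<Longrightarrow> (\<lambda>x. - f x) \<in> E"
  using scale_closed[of f "-1"] by simp

lemma sublinear_on_zero:
  assumes "sublinear_on E q" shows "q (\<lambda>x. 0) = 0"
proof -
  have *: "q (\<lambda>x. 0) \<le> c * q (\<lambda>x. 0)" if "c > 0" for c
    using assms zero_closed that unfolding sublinear_on_def by fastforce
  \<comment> \<open>The factor 2 bounds the value at the zero function below by 0, the factor 1/2
    bounds it above by 0.\<close>
  show ?thesis using *[of 2] *[of "1/2"] by simp
qed

lemma sublinear_on_scale:
  assumes q: "sublinear_on E q" and f: "f \<in> E" and c: "c \<ge> 0"
  shows "q (\<lambda>x. c * f x) = c * q f"
proof (cases "c = 0")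
  case True then show ?thesis using sublinear_on_zero[OF q] by simp
next
  case False
  with c have c: "c > 0" by simp
  have "q (\<lambda>x. inverse c * (c * f x)) \<le> inverse c * q (\<lambda>x. c * f x)"
    using q scale_closed[OF f] c unfolding sublinear_on_def by (metis positive_imp_inverse_positive)
  then have "c * q f \<le> q (\<lambda>x. c * f x)" using c by (simp add: field_simps)
  moreover have "q (\<lambda>x. c * f x) \<le> c * q f" using q f c unfolding sublinear_on_def by blast
  ultimately show ?thesis by simp
qed

lemma sublinear_on_uminus:
  assumes q: "sublinear_on E q" and f: "f \<in> E"
  shows "- q (\<lambda>x. - f x) \<le> q f"
proof -
  have "q (\<lambda>x. f x + - f x) \<le> q f + q (\<lambda>x. - f x)"
    by (rule sublinear_onD(1)[OF q f uminus_closed[OF f]])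
  then show ?thesis using sublinear_on_zero[OF q] by simp
qed

section \<open>Minimal sublinear functionals and linear extension\<close>

text \<open>Zorn's lemma for the reversed pointwise order: a chain is bounded below by its pointwise
  infimum, which is finite since at \<open>f\<close> every member is at least
  \<open>- p (- f)\<close>.\<close>

lemma minimal_sublinear_exists:
  assumes p: "sublinear_on E p"
  shows "\<exists>q. sublinear_on E q \<and> (\<forall>f\<in>E. q f \<le> p f) \<and>
           (\<forall>r. sublinear_on E r \<longrightarrow> (\<forall>f\<in>E. r f \<le> q f) \<longrightarrow> (\<forall>f\<in>E. r f = q f))"
proof -
  \<comment> \<open>Members of \<open>Q\<close> are 0 off \<open>E\<close>, so that the order of
    full functions used in Zorn's lemma agrees with comparison on \<open>E\<close>.\<close>
  define Q where "Q = {q. sublinear_on E q \<and> (\<forall>f\<in>E. q f \<le> p f) \<and> (\<forall>f. f \<notin> E \<longrightarrow> q f = 0)}"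
  have trunc: "sublinear_on E (\<lambda>f. if f \<in> E then q f else 0)" if "sublinear_on E q" for q
    using that add_closed scale_closed unfolding sublinear_on_def by auto
  have "\<exists>q\<in>Q. \<forall>r\<in>Q. r \<le> q \<longrightarrow> r = q"
  proof (rule predicate_Zorn)
    show "partial_order_on Q (relation_of (\<lambda>r q. q \<le> r) Q)"
      by (rule partial_order_on_relation_ofI) auto
  next
    fix C assume C: "C \<in> Chains (relation_of (\<lambda>r q. q \<le> r) Q)"
    then have CQ: "C \<subseteq> Q" and tot: "\<And>r s. r \<in> C \<Longrightarrow> s \<in> C \<Longrightarrow> r \<le> s \<or> s \<le> r"
      unfolding Chains_def relation_of_def by auto
    show "\<exists>q\<in>Q. \<forall>r\<in>C. q \<le> r"
    proof (cases "C = {}")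
      case True
      have "(\<lambda>f. if f \<in> E then p f else 0) \<in> Q" unfolding Q_def using trunc[OF p] by auto
      then show ?thesis using True by blast
    next
      case False
      have low: "- p (\<lambda>x. - f x) \<le> r f" if "r \<in> C" "f \<in> E" for r f
      proof -
        have "sublinear_on E r" "r (\<lambda>x. - f x) \<le> p (\<lambda>x. - f x)"
          using that CQ uminus_closed unfolding Q_def by auto
        then show ?thesis using sublinear_on_uminus[of r f] that by simp
      qed
      have bdd: "bdd_below ((\<lambda>r. r f) ` C)" if "f \<in> E" for f
        using low that by (intro bdd_belowI2) auto
      let ?q = "\<lambda>f. INF r\<in>C. r f"
      have 1: "sublinear_on E ?q"
      proof (rule sublinear_on_INF[OF False add_closed scale_closed bdd])
        fix f g r s assume f: "f \<in> E" and g: "g \<in> E" and rs: "r \<in> C" "s \<in> C"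
        \<comment> \<open>In a chain the smaller of \<open>r\<close> and \<open>s\<close> serves as
          the merged index.\<close>
        obtain t where t: "t \<in> C" "t \<le> r" "t \<le> s" using tot[OF rs] rs by auto
        have "t (\<lambda>x. f x + g x) \<le> t f + t g"
          using t CQ f g unfolding Q_def sublinear_on_def by blast
        also have "\<dots> \<le> r f + s g" using t by (intro add_mono) (auto simp: le_fun_def)
        finally show "\<exists>t\<in>C. t (\<lambda>x. f x + g x) \<le> r f + s g" using t by blast
      next
        fix f c r assume "f \<in> E" "(0::real) < c" "r \<in> C"
        then show "\<exists>t\<in>C. t (\<lambda>x. c * f x) \<le> c * r f"
          using CQ unfolding Q_def sublinear_on_def by blast
      qed auto
      have out: "?q f = 0" if "f \<notin> E" for f
      proof -
        have "r f = 0" if "r \<in> C" for r using \<open>f \<notin> E\<close> CQ that unfolding Q_def by auto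
        then have "(\<lambda>r. r f) ` C = (\<lambda>r. 0) ` C" by (intro image_cong) auto
        then show ?thesis using False by simp
      qed
      have le: "?q f \<le> r f" if "r \<in> C" for r f
      proof (cases "f \<in> E")
        case True then show ?thesis using that bdd by (intro cINF_lower)
      next
        case notin: False
        then have "r f = 0" using CQ that unfolding Q_def by auto
        then show ?thesis using out[OF notin] by simp
      qed
      obtain r0 where r0: "r0 \<in> C" using False by auto
      have "?q f \<le> p f" if "f \<in> E" for f
        using le[OF r0, of f] r0 CQ that unfolding Q_def by force
      then have "?q \<in> Q" using 1 out unfolding Q_def by blast
      then show ?thesis using le by (intro bexI[of _ ?q]) (auto simp: le_fun_def)
    qed
  qed
  then obtain q where q: "q \<in> Q" and min: "\<And>r. r \<in> Q \<Longrightarrow> r \<le> q \<Longrightarrow> r = q" by blast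
  have "r f = q f" if r: "sublinear_on E r" "\<And>f. f \<in> E \<Longrightarrow> r f \<le> q f" and f: "f \<in> E" for r f
  proof -
    let ?r = "\<lambda>f. if f \<in> E then r f else 0"
    have "?r \<in> Q" using trunc[OF r(1)] r(2) q unfolding Q_def by force
    moreover have "?r \<le> q" using r(2) q unfolding Q_def le_fun_def by auto
    ultimately have "?r = q" by (rule min)
    then have "?r f = q f" by (rule fun_cong)
    with f show ?thesis by simp
  qed
  then show ?thesis using q unfolding Q_def by blast
qed

lemma minimal_sublinear_odd:
  assumes q: "sublinear_on E q"
    and min: "\<And>r f. sublinear_on E r \<Longrightarrow> (\<And>f. f \<in> E \<Longrightarrow> r f \<le> q f) \<Longrightarrow> f \<in> E \<Longrightarrow> r f = q f"
    and a: "a \<in> E"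
  shows "q (\<lambda>x. - a x) = - q a"
proof -
  \<comment> \<open>Relaxing \<open>q\<close> along the ray of \<open>a\<close> gives a sublinear functional below \<open>q\<close>; by minimality it is \<open>q\<close>.\<close>
  let ?r = "\<lambda>s f. q (\<lambda>x. f x + s * a x) - s * q a"
  have low: "- q (\<lambda>x. - f x) \<le> ?r s f" if f: "f \<in> E" and s: "s \<ge> 0" for f s
  proof -
    have "q (\<lambda>x. (f x + s * a x) + - f x) \<le> q (\<lambda>x. f x + s * a x) + q (\<lambda>x. - f x)"
      by (rule sublinear_onD(1)[OF q add_closed[OF f scale_closed[OF a]] uminus_closed[OF f]])
    then show ?thesis using sublinear_on_scale[OF q a s] by simp
  qed
  have bdd: "bdd_below ((\<lambda>s. ?r s f) ` {0..})" if "f \<in> E" for f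
    using low that by (intro bdd_belowI2) auto
  let ?q = "\<lambda>f. INF s\<in>{0..}. ?r s f"
  have "sublinear_on E ?q"
  proof (rule sublinear_on_INF[OF _ add_closed scale_closed bdd])
    fix f g and s t :: real assume f: "f \<in> E" and g: "g \<in> E" and st: "s \<in> {0..}" "t \<in> {0..}"
    have "q (\<lambda>x. (f x + s * a x) + (g x + t * a x)) \<le> q (\<lambda>x. f x + s * a x) + q (\<lambda>x. g x + t * a x)"
      by (rule sublinear_onD(1)[OF q add_closed[OF f scale_closed[OF a]] add_closed[OF g scale_closed[OF a]]])
    then have "?r (s + t) (\<lambda>x. f x + g x) \<le> ?r s f + ?r t g" by (simp add: algebra_simps)
    then show "\<exists>k\<in>{0..}. ?r k (\<lambda>x. f x + g x) \<le> ?r s f + ?r t g"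
      using st by (intro bexI[of _ "s + t"]) auto
  next
    fix f and c s :: real assume f: "f \<in> E" and c: "0 < c" and s: "s \<in> {0..}"
    have "q (\<lambda>x. c * (f x + s * a x)) \<le> c * q (\<lambda>x. f x + s * a x)"
      by (rule sublinear_onD(2)[OF q add_closed[OF f scale_closed[OF a]] c])
    then have "?r (c * s) (\<lambda>x. c * f x) \<le> c * ?r s f" by (simp add: algebra_simps)
    then show "\<exists>k\<in>{0..}. ?r k (\<lambda>x. c * f x) \<le> c * ?r s f"
      using s c by (intro bexI[of _ "c * s"]) auto
  qed auto
  moreover have "?q f \<le> q f" if "f \<in> E" for f
    using cINF_lower[OF bdd[OF that], of 0] by simp
  ultimately have "?q (\<lambda>x. - a x) = q (\<lambda>x. - a x)" using min uminus_closed[OF a] by blast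
  \<comment> \<open>The shift \<open>s = 1\<close> moves \<open>- a\<close> to the zero function,
    which leaves \<open>0 - q a\<close>.\<close>
  moreover have "?q (\<lambda>x. - a x) \<le> - q a"
    using cINF_lower[OF bdd[OF uminus_closed[OF a]], of 1] sublinear_on_zero[OF q] by simp
  ultimately show ?thesis using sublinear_on_uminus[OF q a] by simp
qed

text \<open>The linear functional to be extended is given by its graph \<open>G\<close>; that \<open>G\<close> is single-valued
  is a consequence of the domination hypothesis.\<close>

theorem hahn_banach_graph:
  assumes p: "sublinear_on E p"
    and G0: "((\<lambda>x. 0), 0) \<in> G"
    and G_add: "\<And>f g s t. (f, s) \<in> G \<Longrightarrow> (g, t) \<in> G \<Longrightarrow> ((\<lambda>x. f x + g x), s + t) \<in> G"
    and G_scale: "\<And>f s c. (f, s) \<in> G \<Longrightarrow> ((\<lambda>x. c * f x), c * s) \<in> G"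
    and GE: "\<And>f s. (f, s) \<in> G \<Longrightarrow> f \<in> E"
    and dom: "\<And>f s. (f, s) \<in> G \<Longrightarrow> s \<le> p f"
  obtains L where "\<And>f g. f \<in> E \<Longrightarrow> g \<in> E \<Longrightarrow> L (\<lambda>x. f x + g x) = L f + L g"
    and "\<And>f c. f \<in> E \<Longrightarrow> L (\<lambda>x. c * f x) = c * L f"
    and "\<And>f. f \<in> E \<Longrightarrow> L f \<le> p f"
    and "\<And>f s. (f, s) \<in> G \<Longrightarrow> L f = s"
proof -
  let ?r = "\<lambda>(h, s) f. p (\<lambda>x. f x + h x) - s"
  have low: "- p (\<lambda>x. - f x) \<le> ?r j f" if f: "f \<in> E" and j: "j \<in> G" for f j
  proof -
    obtain h s where [simp]: "j = (h, s)" by (cases j)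
    have h: "h \<in> E" "s \<le> p h" using j GE dom by auto
    have "p (\<lambda>x. (f x + h x) + - f x) \<le> p (\<lambda>x. f x + h x) + p (\<lambda>x. - f x)"
      by (rule sublinear_onD(1)[OF p add_closed[OF f h(1)] uminus_closed[OF f]])
    then show ?thesis using h by simp
  qed
  have bdd: "bdd_below ((\<lambda>j. ?r j f) ` G)" if "f \<in> E" for f
    using low that by (intro bdd_belowI2) auto
  \<comment> \<open>\<open>?p h \<le> s\<close> and \<open>?p (- h) \<le> - s\<close> for \<open>(h, s) \<in> G\<close>, so every linear functional below \<open>?p\<close> extends \<open>G\<close>.\<close>
  let ?p = "\<lambda>f. INF j\<in>G. ?r j f"
  have p': "sublinear_on E ?p"
  proof (rule sublinear_on_INF[OF _ add_closed scale_closed bdd])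
    show "G \<noteq> {}" using G0 by auto
  next
    fix f g i j assume f: "f \<in> E" and g: "g \<in> E" and ij: "i \<in> G" "j \<in> G"
    obtain h s h' s' where [simp]: "i = (h, s)" "j = (h', s')" by (cases i, cases j)
    have h: "h \<in> E" "h' \<in> E" using ij GE by auto
    have "p (\<lambda>x. (f x + h x) + (g x + h' x)) \<le> p (\<lambda>x. f x + h x) + p (\<lambda>x. g x + h' x)"
      by (rule sublinear_onD(1)[OF p add_closed[OF f h(1)] add_closed[OF g h(2)]])
    then show "\<exists>k\<in>G. ?r k (\<lambda>x. f x + g x) \<le> ?r i f + ?r j g"
      using G_add[of h s h' s'] ij by (intro bexI[of _ "((\<lambda>x. h x + h' x), s + s')"]) (auto simp: algebra_simps)
  next
    fix f j and c :: real assume f: "f \<in> E" and c: "0 < c" and j: "j \<in> G"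
    obtain h s where [simp]: "j = (h, s)" by (cases j)
    have h: "h \<in> E" using j GE by auto
    have "p (\<lambda>x. c * (f x + h x)) \<le> c * p (\<lambda>x. f x + h x)"
      by (rule sublinear_onD(2)[OF p add_closed[OF f h] c])
    then show "\<exists>k\<in>G. ?r k (\<lambda>x. c * f x) \<le> c * ?r j f"
      using G_scale[of h s c] j by (intro bexI[of _ "((\<lambda>x. c * h x), c * s)"]) (auto simp: algebra_simps)
  qed
  obtain L where L: "sublinear_on E L" and Lp: "\<And>f. f \<in> E \<Longrightarrow> L f \<le> ?p f"
    and min: "\<And>r f. sublinear_on E r \<Longrightarrow> (\<And>f. f \<in> E \<Longrightarrow> r f \<le> L f) \<Longrightarrow> f \<in> E \<Longrightarrow> r f = L f"
    using minimal_sublinear_exists[OF p'] by blast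
  have neg: "L (\<lambda>x. - f x) = - L f" if "f \<in> E" for f
    by (rule minimal_sublinear_odd[OF L _ that]) (rule min)
  show thesis
  proof (rule that[of L])
    fix f g assume f: "f \<in> E" and g: "g \<in> E"
    have "L (\<lambda>x. f x + g x) \<le> L f + L g" by (rule sublinear_onD(1)[OF L f g])
    \<comment> \<open>Since \<open>L\<close> is odd, subadditivity at the negatives is
      superadditivity at \<open>f\<close> and \<open>g\<close>.\<close>
    moreover have "L (\<lambda>x. - f x + - g x) \<le> L (\<lambda>x. - f x) + L (\<lambda>x. - g x)"
      by (rule sublinear_onD(1)[OF L uminus_closed[OF f] uminus_closed[OF g]])
    ultimately show "L (\<lambda>x. f x + g x) = L f + L g"
      using neg[OF f] neg[OF g] neg[OF add_closed[OF f g]] by simp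
  next
    fix f and c :: real assume f: "f \<in> E"
    show "L (\<lambda>x. c * f x) = c * L f"
    proof (cases "c \<ge> 0")
      case True then show ?thesis using sublinear_on_scale[OF L f] by simp
    next
      case False
      then have "L (\<lambda>x. - c * f x) = - c * L f" using sublinear_on_scale[OF L f, of "- c"] by simp
      then show ?thesis using neg[OF scale_closed[OF f, of c]] by simp
    qed
  next
    fix f assume f: "f \<in> E"
    have "?p f \<le> p f" using cINF_lower[OF bdd[OF f] G0] by simp
    then show "L f \<le> p f" using Lp[OF f] by simp
  next
    fix f s assume fs: "(f, s) \<in> G"
    have f: "f \<in> E" using GE[OF fs] .
    have *: "L f \<le> s" if "(f, s) \<in> G" for f s
    proof -
      have f: "f \<in> E" using GE[OF that] .
      \<comment> \<open>The index \<open>(- f, - s)\<close> of the infimum contributes the value of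
        \<open>p\<close> at the zero function plus \<open>s\<close>, that is
        \<open>s\<close>.\<close>
      have "?p f \<le> ?r ((\<lambda>x. - 1 * f x), - 1 * s) f"
        using cINF_lower[OF bdd[OF f] G_scale[OF that, of "-1"]] by simp
      then show ?thesis using Lp[OF f] sublinear_on_zero[OF p] by simp
    qed
    \<comment> \<open>The same bound at \<open>(- f, - s)\<close> gives
      \<open>- L f \<le> - s\<close>, the missing inequality.\<close>
    from *[OF fs] *[OF G_scale[OF fs, of "-1"]] neg[OF f] show "L f = s" by simp
  qed
qed

end

section \<open>The dual of \<open>L\<^sup>1\<close>\<close>

text \<open>The set function \<open>L (indicator C)\<close> may be negative, but
  \<open>measure M C + L (indicator C)\<close> is a finite measure, because \<open>bound\<close>
  keeps the second summand within \<open>measure M C\<close> in absolute value. Its Radon-Nikodym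
  density minus 1 is the desired \<open>g\<close>, up to a null set.\<close>

lemma (in finite_measure) L1_dual_finite:
  fixes L :: "('a \<Rightarrow> real) \<Rightarrow> real"
  assumes add: "\<And>f g. integrable M f \<Longrightarrow> integrable M g \<Longrightarrow> L (\<lambda>x. f x + g x) = L f + L g"
    and scale: "\<And>f c. integrable M f \<Longrightarrow> L (\<lambda>x. c * f x) = c * L f"
    and bound: "\<And>f. integrable M f \<Longrightarrow> L f \<le> (\<integral>x. \<bar>f x\<bar> \<partial>M)"
  obtains g where "g \<in> borel_measurable M" "\<And>x. \<bar>g x\<bar> \<le> 1"
    "\<And>f. integrable M f \<Longrightarrow> L f = (\<integral>x. g x * f x \<partial>M)"
proof -
  have neg: "L (\<lambda>x. - f x) = - L f" if "integrable M f" for f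
    using scale[OF that, of "-1"] by simp
  have diff: "L (\<lambda>x. f x - g x) = L f - L g" if "integrable M f" "integrable M g" for f g
    using add[of f "\<lambda>x. - g x"] neg[of g] that by simp
  have abs_bound: "\<bar>L f\<bar> \<le> (\<integral>x. \<bar>f x\<bar> \<partial>M)" if "integrable M f" for f
    using bound[of f] bound[of "\<lambda>x. - f x"] neg[OF that] that by (simp add: abs_le_iff)
  \<comment> \<open>Continuity under \<open>L\<^sup>1\<close> convergence; it yields countable
    additivity below and the limit case of the final induction.\<close>
  have L_cont: "(\<lambda>i. L (s i)) \<longlonglongrightarrow> L f"
    if "\<And>i. integrable M (s i)" "integrable M f" "(\<lambda>i. \<integral>x. \<bar>s i x - f x\<bar> \<partial>M) \<longlonglongrightarrow> 0" for s f
  proof (rule LIM_zero_cancel, rule Lim_null_comparison[OF _ that(3)])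
    show "\<forall>\<^sub>F i in sequentially. norm (L (s i) - L f) \<le> (\<integral>x. \<bar>s i x - f x\<bar> \<partial>M)"
      using that abs_bound[of "\<lambda>x. s i x - f x" for i] by (simp add: diff)
  qed
  have ind[simp]: "integrable M (indicator C :: 'a \<Rightarrow> real)" if "C \<in> sets M" for C
    using that by (simp add: integrable_indicator_iff emeasure_finite less_top[symmetric])
  have ind_bound: "\<bar>L (indicator C)\<bar> \<le> measure M C" if "C \<in> sets M" for C
    using abs_bound[OF ind[OF that]] that by simp
  define l where "l C = measure M C + L (indicator C)" for C
  have l0: "0 \<le> l C" if "C \<in> sets M" for C using ind_bound[OF that] unfolding l_def by linarith
  have l2: "l C \<le> 2 * measure M C" if "C \<in> sets M" for C using ind_bound[OF that] unfolding l_def by linarith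
  have l_empty: "l {} = 0" using ind_bound[of "{}"] unfolding l_def by simp
  have l_sums: "(\<lambda>i. l (C i)) sums l (\<Union>i. C i)" if C: "range C \<subseteq> sets M" "disjoint_family C" for C :: "nat \<Rightarrow> 'a set"
  proof -
    have [measurable]: "C i \<in> sets M" for i using C by auto
    have "(\<lambda>i. measure M (C i)) sums measure M (\<Union>i. C i)"
      by (rule finite_measure_UNION[OF C])
    moreover have "(\<lambda>i. L (indicator (C i))) sums L (indicator (\<Union>i. C i))"
    proof -
      have eq: "(\<Sum>i<n. L (indicator (C i))) = L (\<lambda>x. \<Sum>i<n. indicator (C i) x)" for n
      proof (induct n)
        case 0 then show ?case using scale[of "\<lambda>x. 0" 0] by simp
      next
        case (Suc n) then show ?case by (subst sum.lessThan_Suc, subst Suc, subst add[symmetric]) auto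
      qed
      have lim: "(\<lambda>n. \<Sum>i<n. indicator (C i) x :: real) \<longlonglongrightarrow> indicator (\<Union>i. C i) x" for x
        using indicator_sums[of C x] C(2) unfolding sums_def disjoint_family_on_def by blast
      have "(\<lambda>n. \<integral>x. \<bar>(\<Sum>i<n. indicator (C i) x) - indicator (\<Union>i. C i) x :: real\<bar> \<partial>M) \<longlonglongrightarrow> (\<integral>x. 0 \<partial>M)"
      \<comment> \<open>Disjointness makes each partial sum an indicator, so the difference stays
        within 1, which is integrable as the measure is finite.\<close>
      proof (rule integral_dominated_convergence[where w="\<lambda>x. 1"])
        show "AE x in M. (\<lambda>n. \<bar>(\<Sum>i<n. indicator (C i) x) - indicator (\<Union>i. C i) x :: real\<bar>) \<longlonglongrightarrow> 0"
          using lim by (intro AE_I2) (auto intro!: tendsto_rabs_zero simp: LIM_zero_iff)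
        show "AE x in M. norm \<bar>(\<Sum>i<n. indicator (C i) x) - indicator (\<Union>i. C i) x :: real\<bar> \<le> 1" for n
        proof (rule AE_I2)
          fix x
          have "(\<Sum>i<n. indicator (C i) x :: real) = indicator (\<Union>i<n. C i) x"
            using C(2) by (subst indicator_UN_disjoint) (auto intro: disjoint_family_on_mono)
          then show "norm \<bar>(\<Sum>i<n. indicator (C i) x) - indicator (\<Union>i. C i) x :: real\<bar> \<le> 1"
            by (auto split: split_indicator)
        qed
      qed auto
      then show ?thesis unfolding sums_def eq
        by (intro L_cont) auto
    qed
    ultimately show ?thesis unfolding l_def by (rule sums_add)
  qed
  define N where "N = measure_of (space M) (sets M) (\<lambda>C. ennreal (l C))"
  have sN[simp]: "sets N = sets M" "space N = space M" unfolding N_def by auto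
  have eN: "emeasure N C = ennreal (l C)" if "C \<in> sets M" for C
    unfolding N_def
  proof (rule emeasure_measure_of_sigma[OF sets.sigma_algebra_axioms _ _ that])
    show "positive (sets M) (\<lambda>C. ennreal (l C))" by (simp add: positive_def l_empty)
    show "countably_additive (sets M) (\<lambda>C. ennreal (l C))"
      unfolding countably_additive_def
    proof safe
      fix C :: "nat \<Rightarrow> 'a set" assume C: "range C \<subseteq> sets M" "disjoint_family C"
      have nn: "0 \<le> l (C i)" for i using C(1) l0 by auto
      show "(\<Sum>i. ennreal (l (C i))) = ennreal (l (\<Union>i. C i))"
        using l_sums[OF C] nn by (intro suminf_ennreal_eq)
    qed
  qed
  have "absolutely_continuous M N"
    unfolding absolutely_continuous_def
  proof
    fix C assume "C \<in> null_sets M"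
    then have "C \<in> sets M" "measure M C = 0" by (auto simp: null_sets_def measure_def)
    then show "C \<in> null_sets N" using l2[of C] l0[of C] by (auto simp: null_sets_def eN)
  qed
  then obtain f0 where f0[measurable]: "f0 \<in> borel_measurable M" and dens: "density M f0 = N"
    using Radon_Nikodym[of N] by auto
  have f0_fin: "(\<integral>\<^sup>+x. f0 x \<partial>M) = ennreal (l (space M))"
    using eN[of "space M"] unfolding dens[symmetric] by (simp add: emeasure_density cong: nn_integral_cong)
  then have "AE x in M. f0 x \<noteq> \<infinity>" by (intro nn_integral_PInf_AE) auto
  define f where "f x = enn2real (f0 x)" for x
  have [measurable]: "f \<in> borel_measurable M" unfolding f_def by measurable
  have f0f: "AE x in M. f0 x = ennreal (f x)"
    using \<open>AE x in M. f0 x \<noteq> \<infinity>\<close> by eventually_elim (simp add: f_def less_top)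
  have "(\<integral>\<^sup>+x. ennreal (f x) \<partial>M) = ennreal (l (space M))"
    unfolding f0_fin[symmetric] using f0f by (intro nn_integral_cong_AE) (auto elim: eventually_mono)
  then have fint: "integrable M f" unfolding f_def by (intro integrableI_nonneg) auto
  have set_int: "set_integrable M C f" if "C \<in> sets M" for C
    using fint that unfolding set_integrable_def by (rule integrable_mult_indicator[rotated])
  have lf: "l C = (\<integral>x\<in>C. f x \<partial>M)" if [measurable]: "C \<in> sets M" for C
  proof -
    have "ennreal (l C) = (\<integral>\<^sup>+x. f0 x * indicator C x \<partial>M)"
      unfolding eN[OF that, symmetric] dens[symmetric] by (simp add: emeasure_density)
    also have "\<dots> = (\<integral>\<^sup>+x. ennreal (indicator C x * f x) \<partial>M)"
      using f0f by (intro nn_integral_cong_AE) (auto elim!: eventually_mono split: split_indicator)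
    also have "\<dots> = ennreal (\<integral>x\<in>C. f x \<partial>M)"
      using set_int[OF that] unfolding set_lebesgue_integral_def set_integrable_def
      by (subst nn_integral_eq_integral) (auto simp: f_def)
    finally show ?thesis
      using l0[OF that] by (subst (asm) ennreal_inj) (auto simp: f_def set_lebesgue_integral_def intro!: Bochner_Integration.integral_nonneg)
  qed
  have const_int: "set_integrable M C (\<lambda>x. c)" if "C \<in> sets M" for C and c :: real
    using that unfolding set_integrable_def by simp
  \<comment> \<open>The bound \<open>l C \<le> 2 * measure M C\<close> on sets passes to the
    density.\<close>
  have "AE x in M. 0 \<le> 2 - f x"
  proof (rule density_nonneg)
    show "integrable M (\<lambda>x. 2 - f x)" using fint by simp
    fix C assume C: "C \<in> sets M"
    have "(\<integral>x\<in>C. 2 - f x \<partial>M) = 2 * measure M C - l C"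
      using C set_integral_diff(2)[OF const_int[OF C, of 2] set_int[OF C]] by (simp add: lf set_lebesgue_integral_def)
    then show "0 \<le> (\<integral>x\<in>C. 2 - f x \<partial>M)" using l2[OF C] by simp
  qed
  \<comment> \<open>\<open>f\<close> is nonnegative everywhere but at most 2 only almost everywhere;
    the truncation makes \<open>g\<close> bounded by 1 at every point.\<close>
  define g where "g x = min 1 (f x - 1)" for x
  have [measurable]: "g \<in> borel_measurable M" unfolding g_def by measurable
  have g1: "\<bar>g x\<bar> \<le> 1" for x 
    using enn2real_nonneg[of "f0 x"] unfolding g_def f_def by (auto simp: abs_le_iff min_def)
  have gf: "AE x in M. g x = f x - 1" using \<open>AE x in M. 0 \<le> 2 - f x\<close> by eventually_elim (auto simp: g_def)
  have gint: "integrable M (\<lambda>x. g x * h x)" if "integrable M h" for h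
    using that g1 by (intro Bochner_Integration.integrable_bound[OF that]) (auto simp: abs_mult intro!: mult_left_le_one_le)
  have "L h = (\<integral>x. g x * h x \<partial>M)" if "integrable M h" for h
    using that
  proof (induct h)
    case (base C c)
    then have [measurable]: "C \<in> sets M" by simp
    have "L (\<lambda>x. indicator C x *\<^sub>R c) = c * L (indicator C)"
      using scale[of "indicator C" c] by (simp add: mult.commute)
    also have "L (indicator C) = (\<integral>x\<in>C. f x - 1 \<partial>M)"
      using lf[of C] set_integral_diff(2)[OF set_int[of C] const_int[of C 1]] unfolding l_def by (simp add: set_lebesgue_integral_def)
    also have "\<dots> = (\<integral>x. g x * indicator C x \<partial>M)"
      unfolding set_lebesgue_integral_def using gf
      by (intro integral_cong_AE) (auto simp: mult.commute)
    also have "c * \<dots> = (\<integral>x. g x * (indicator C x *\<^sub>R c) \<partial>M)"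
      by (subst integral_mult_right_zero[symmetric]) (simp add: ac_simps)
    finally show ?case .
  next
    case (add h k)
    then show ?case using assms(1)[of h k] gint[of h] gint[of k] by (simp add: distrib_left)
  next
    case (lim h s)
    note [measurable] = borel_measurable_integrable[OF lim(1)] borel_measurable_integrable[OF lim(5)]
    have "(\<lambda>i. \<integral>x. \<bar>s i x - h x\<bar> \<partial>M) \<longlonglongrightarrow> (\<integral>x. 0 \<partial>M)"
    \<comment> \<open>The induction rule supplies
      \<open>\<bar>s i x\<bar> \<le> 2 * \<bar>h x\<bar>\<close>, hence the constant 3 for the
      difference.\<close>
    proof (rule integral_dominated_convergence[where w="\<lambda>x. 3 * \<bar>h x\<bar>"])
      show "AE x in M. (\<lambda>i. \<bar>s i x - h x\<bar>) \<longlonglongrightarrow> 0"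
        using lim(3) by (intro AE_I2) (auto intro!: tendsto_rabs_zero simp: LIM_zero_iff)
      show "AE x in M. norm \<bar>s i x - h x\<bar> \<le> 3 * \<bar>h x\<bar>" for i
        using lim(4)[of _ i] by (intro AE_I2) force
    qed (use lim in auto)
    then have "(\<lambda>i. L (s i)) \<longlonglongrightarrow> L h" by (intro L_cont lim) simp
    moreover have "(\<lambda>i. \<integral>x. g x * s i x \<partial>M) \<longlonglongrightarrow> (\<integral>x. g x * h x \<partial>M)"
    proof (rule integral_dominated_convergence[where w="\<lambda>x. 2 * \<bar>h x\<bar>"])
      show "AE x in M. (\<lambda>i. g x * s i x) \<longlonglongrightarrow> g x * h x"
        using lim(3) by (intro AE_I2 tendsto_mult_left) auto
      show "AE x in M. norm (g x * s i x) \<le> 2 * \<bar>h x\<bar>" for i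
      proof (rule AE_I2)
        fix x assume "x \<in> space M"
        have "norm (g x * s i x) \<le> 1 * norm (s i x)"
          unfolding norm_mult using g1[of x] by (intro mult_right_mono) auto
        then show "norm (g x * s i x) \<le> 2 * \<bar>h x\<bar>" using lim(4)[OF \<open>x \<in> space M\<close>, of i] by simp
      qed
    qed (use lim in auto)
    ultimately show ?case using lim(2) LIMSEQ_unique by simp
  qed
  with g1 show thesis by (intro that[of g]) auto
qed

text \<open>Reduction to a finite measure: with a positive integrable \<open>h\<close>, the
  functional \<open>f \<mapsto> L (h * f)\<close> satisfies the same bound on
  \<open>L\<^sup>1\<close> of the finite measure \<open>?N\<close>, and the function representing it
  there represents \<open>L\<close> as well.\<close>

lemma (in sigma_finite_measure) L1_dual:
  fixes L :: "('a \<Rightarrow> real) \<Rightarrow> real"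
  assumes add: "\<And>f g. integrable M f \<Longrightarrow> integrable M g \<Longrightarrow> L (\<lambda>x. f x + g x) = L f + L g"
    and scale: "\<And>f c. integrable M f \<Longrightarrow> L (\<lambda>x. c * f x) = c * L f"
    and bound: "\<And>f. integrable M f \<Longrightarrow> L f \<le> (\<integral>x. \<bar>f x\<bar> \<partial>M)"
  obtains g where "g \<in> borel_measurable M" "\<And>x. \<bar>g x\<bar> \<le> 1"
    "\<And>f. integrable M f \<Longrightarrow> L f = (\<integral>x. g x * f x \<partial>M)"
proof -
  obtain h0 where h0[measurable]: "h0 \<in> borel_measurable M" "integral\<^sup>N M h0 \<noteq> \<infinity>"
    "\<And>x. x \<in> space M \<Longrightarrow> 0 < h0 x \<and> h0 x < \<infinity>"
    using Ex_finite_integrable_function by blast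
  define h where "h x = enn2real (h0 x)" for x
  have h[measurable]: "h \<in> borel_measurable M" unfolding h_def by measurable
  have hpos: "h x > 0" if "x \<in> space M" for x
    using h0(3)[OF that] unfolding h_def by (simp add: enn2real_positive_iff)
  have hnn: "h x \<ge> 0" for x unfolding h_def by simp
  have hh0: "ennreal (h x) = h0 x" if "x \<in> space M" for x
    using h0(3)[OF that] unfolding h_def by simp
  let ?N = "density M (\<lambda>x. ennreal (h x))"
  have "emeasure ?N (space ?N) = integral\<^sup>N M h0"
    by (simp add: emeasure_density hh0 cong: nn_integral_cong)
  then interpret N: finite_measure ?N using h0(2) by (intro finite_measureI) simp
  have int: "integrable ?N f \<longleftrightarrow> integrable M (\<lambda>x. h x * f x)" if "f \<in> borel_measurable M" for f :: "'a \<Rightarrow> real"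
    using that hnn by (simp add: integrable_density)
  have intD: "integrable M (\<lambda>x. h x * f x)" if "integrable ?N f" for f :: "'a \<Rightarrow> real"
    using that int[of f] borel_measurable_integrable[OF that] by simp
  obtain g where g: "g \<in> borel_measurable ?N" "\<And>x. \<bar>g x\<bar> \<le> 1"
    and Lg: "\<And>f. integrable ?N f \<Longrightarrow> L (\<lambda>x. h x * f x) = (\<integral>x. g x * f x \<partial>?N)"
  proof (rule N.L1_dual_finite[of "\<lambda>f. L (\<lambda>x. h x * f x)"])
    show "L (\<lambda>x. h x * (f x + k x)) = L (\<lambda>x. h x * f x) + L (\<lambda>x. h x * k x)"
      if "integrable ?N f" "integrable ?N k" for f k
      using add[OF intD intD, OF that] by (simp add: distrib_left)
    show "L (\<lambda>x. h x * (c * f x)) = c * L (\<lambda>x. h x * f x)" if "integrable ?N f" for f c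
      using scale[OF intD[OF that], of c] by (simp add: ac_simps)
    show "L (\<lambda>x. h x * f x) \<le> (\<integral>x. \<bar>f x\<bar> \<partial>?N)" if "integrable ?N f" for f
    proof -
      have [measurable]: "f \<in> borel_measurable M" using borel_measurable_integrable[OF that] by simp
      show ?thesis using bound[OF intD[OF that]] hnn by (simp add: integral_density abs_mult)
    qed
  qed blast
  \<comment> \<open>\<open>h\<close> may vanish outside \<open>space M\<close>, where
    \<open>h * (f / h)\<close> can then differ from \<open>f\<close>. As \<open>L\<close> acts on
    functions, the difference has to be shown to contribute nothing.\<close>
  have L0: "L f = 0" if "\<And>x. x \<in> space M \<Longrightarrow> f x = 0" "integrable M f" for f
  proof -
    have "(\<integral>x. \<bar>f x\<bar> \<partial>M) = (\<integral>x. 0 \<partial>M)" using that(1) by (intro Bochner_Integration.integral_cong) auto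
    then show ?thesis using bound[OF that(2)] bound[of "\<lambda>x. - f x"] scale[OF that(2), of "-1"] that(2) by simp
  qed
  show thesis
  proof (rule that[of g])
    fix f :: "'a \<Rightarrow> real" assume f: "integrable M f"
    have [measurable]: "f \<in> borel_measurable M" "g \<in> borel_measurable M" using f g by auto
    have eq: "h x * (f x / h x) = f x" if "x \<in> space M" for x using hpos[OF that] by simp
    have fi: "integrable ?N (\<lambda>x. f x / h x)"
    proof (subst int)
      show "integrable M (\<lambda>x. h x * (f x / h x))"
        using f Bochner_Integration.integrable_cong[of M M "\<lambda>x. h x * (f x / h x)" f, OF refl eq] by blast
    qed measurable
    have "L f = L (\<lambda>x. h x * (f x / h x)) + L (\<lambda>x. f x - h x * (f x / h x))"
      using add[OF intD[OF fi], of "\<lambda>x. f x - h x * (f x / h x)"] f intD[OF fi] by simp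
    also have "L (\<lambda>x. f x - h x * (f x / h x)) = 0"
    proof (rule L0)
      show "f x - h x * (f x / h x) = 0" if "x \<in> space M" for x using eq[OF that] by (simp only: diff_self)
      show "integrable M (\<lambda>x. f x - h x * (f x / h x))"
        by (rule Bochner_Integration.integrable_diff[OF f intD[OF fi]])
    qed
    also have "L (\<lambda>x. h x * (f x / h x)) = (\<integral>x. g x * (f x / h x) \<partial>?N)" by (rule Lg[OF fi])
    also have "\<dots> = (\<integral>x. h x * (g x * (f x / h x)) \<partial>M)" using hnn by (simp add: integral_density)
    also have "\<dots> = (\<integral>x. g x * f x \<partial>M)"
      using hpos by (intro Bochner_Integration.integral_cong) (auto simp: less_imp_neq[symmetric])
    finally show "L f = (\<integral>x. g x * f x \<partial>M)" by simp
  qed (use g in auto)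
qed

section \<open>Square-integrable functions and soft thresholding\<close>

lemma L2_mult_integrable:
  assumes "L2 \<nu> f" "L2 \<nu> g"
  shows "integrable \<nu> (\<lambda>x. f x * g x)"
proof (rule Bochner_Integration.integrable_bound)
  show "integrable \<nu> (\<lambda>x. (f x)\<^sup>2 + (g x)\<^sup>2)" using assms unfolding L2_def by auto
  show "(\<lambda>x. f x * g x) \<in> borel_measurable \<nu>" using assms unfolding L2_def by auto
  have "\<bar>a * b\<bar> \<le> a\<^sup>2 + b\<^sup>2" for a b :: real
  proof -
    have "2 * \<bar>a\<bar> * \<bar>b\<bar> \<le> a\<^sup>2 + b\<^sup>2" using sum_squares_bound[of "\<bar>a\<bar>" "\<bar>b\<bar>"] by simp
    moreover have "0 \<le> \<bar>a\<bar> * \<bar>b\<bar>" by simp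
    ultimately show ?thesis unfolding abs_mult by linarith
  qed
  then show "AE x in \<nu>. norm (f x * g x) \<le> norm ((f x)\<^sup>2 + (g x)\<^sup>2)" by (intro AE_I2) simp
qed

lemma L2_add:
  assumes "L2 \<nu> f" "L2 \<nu> g" shows "L2 \<nu> (\<lambda>x. f x + g x)"
  using assms L2_mult_integrable[OF assms] unfolding L2_def power2_sum by (auto simp: mult.assoc)

lemma L2_scale: "L2 \<nu> f \<Longrightarrow> L2 \<nu> (\<lambda>x. c * f x)"
  unfolding L2_def power_mult_distrib by auto

lemma L2_zero: "L2 \<nu> (\<lambda>x. 0)"
  unfolding L2_def by simp

text \<open>Vanishing on \<open>[-\<epsilon>, \<epsilon>]\<close> confines a thresholded
  \<open>L\<^sup>2\<close> function to a set of finite measure; being monotone and 1-Lipschitz, the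
  map neither reverses nor enlarges differences.\<close>

definition soft :: "real \<Rightarrow> real \<Rightarrow> real" where
  "soft \<epsilon> t = (if t > \<epsilon> then t - \<epsilon> else if t < - \<epsilon> then t + \<epsilon> else 0)"

lemma soft_measurable [measurable]: "soft \<epsilon> \<in> borel_measurable borel"
  unfolding soft_def by measurable

lemma soft_mono: "\<epsilon> > 0 \<Longrightarrow> s \<le> t \<Longrightarrow> soft \<epsilon> s \<le> soft \<epsilon> t"
  unfolding soft_def by auto

lemma soft_lipschitz: "\<epsilon> > 0 \<Longrightarrow> \<bar>soft \<epsilon> s - soft \<epsilon> t\<bar> \<le> \<bar>s - t\<bar>"
  unfolding soft_def by auto

lemma soft_bound: "\<epsilon> > 0 \<Longrightarrow> \<bar>soft \<epsilon> t\<bar> \<le> \<bar>t\<bar>"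
  unfolding soft_def by auto

text \<open>A Chebyshev-type bound: \<open>soft\<close> is nonzero only where
  \<open>\<epsilon> < \<bar>t\<bar>\<close>. It turns square integrability into
  integrability.\<close>

lemma soft_bound_square:
  assumes "\<epsilon> > 0" shows "\<epsilon> * \<bar>soft \<epsilon> t\<bar> \<le> t\<^sup>2"
proof (cases "\<bar>t\<bar> \<le> \<epsilon>")
  case True then show ?thesis unfolding soft_def by auto
next
  case False
  then have "\<epsilon> * \<bar>soft \<epsilon> t\<bar> \<le> \<bar>t\<bar> * \<bar>t\<bar>"
    using assms soft_bound[OF assms, of t] by (intro mult_mono) auto
  then show ?thesis by (simp add: power2_eq_square)
qed

lemma soft_tendsto: "(\<lambda>n. soft (1 / real (Suc n)) t) \<longlonglongrightarrow> t"
proof (rule LIM_zero_cancel, rule Lim_null_comparison[OF _ LIMSEQ_inverse_real_of_nat])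
  show "\<forall>\<^sub>F n in sequentially. norm (soft (1 / real (Suc n)) t - t) \<le> inverse (real (Suc n))"
    unfolding soft_def by (intro always_eventually allI) (auto simp: inverse_eq_divide)
qed

lemma
  assumes w: "L2 \<nu> w" and e: "\<epsilon> > 0"
  shows L2_soft: "L2 \<nu> (\<lambda>x. soft \<epsilon> (w x))"
    and integrable_soft: "integrable \<nu> (\<lambda>x. soft \<epsilon> (w x))"
proof -
  have [measurable]: "w \<in> borel_measurable \<nu>" and i: "integrable \<nu> (\<lambda>x. (w x)\<^sup>2)"
    using w unfolding L2_def by auto
  have "integrable \<nu> (\<lambda>x. (soft \<epsilon> (w x))\<^sup>2)"
    by (rule Bochner_Integration.integrable_bound[OF i])
       (auto intro!: AE_I2 simp: abs_le_square_iff[symmetric] soft_bound[OF e])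
  then show "L2 \<nu> (\<lambda>x. soft \<epsilon> (w x))" unfolding L2_def by auto
  show "integrable \<nu> (\<lambda>x. soft \<epsilon> (w x))"
  proof (rule Bochner_Integration.integrable_bound[OF integrable_mult_right[OF i, of "1 / \<epsilon>"]])
    show "AE x in \<nu>. norm (soft \<epsilon> (w x)) \<le> norm (1 / \<epsilon> * (w x)\<^sup>2)"
      using soft_bound_square[OF e] e by (intro AE_I2) (auto simp: field_simps)
  qed measurable
qed

lemma integral_mult_soft_tendsto:
  assumes v: "L2 \<nu> v" and w: "L2 \<nu> w"
  shows "(\<lambda>n. \<integral>x. v x * soft (1 / real (Suc n)) (w x) \<partial>\<nu>) \<longlonglongrightarrow> (\<integral>x. v x * w x \<partial>\<nu>)"
proof (rule integral_dominated_convergence[where w="\<lambda>x. \<bar>v x * w x\<bar>"])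
  have [measurable]: "v \<in> borel_measurable \<nu>" "w \<in> borel_measurable \<nu>"
    using v w unfolding L2_def by auto
  show "(\<lambda>x. v x * w x) \<in> borel_measurable \<nu>" by measurable
  show "(\<lambda>x. v x * soft (1 / real (Suc n)) (w x)) \<in> borel_measurable \<nu>" for n by measurable
  show "integrable \<nu> (\<lambda>x. \<bar>v x * w x\<bar>)" using L2_mult_integrable[OF v w] by simp
  show "AE x in \<nu>. (\<lambda>n. v x * soft (1 / real (Suc n)) (w x)) \<longlonglongrightarrow> v x * w x"
    by (intro AE_I2 tendsto_mult_left soft_tendsto)
  show "AE x in \<nu>. norm (v x * soft (1 / real (Suc n)) (w x)) \<le> \<bar>v x * w x\<bar>" for n
    by (intro AE_I2) (auto simp: abs_mult intro!: mult_left_mono soft_bound)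
qed

section \<open>Reversible random walks\<close>

locale reversible_walk =
  fixes \<nu> :: "'a measure" and m :: "'a \<Rightarrow> 'a measure"
  assumes kernel: "m \<in> measurable \<nu> (prob_algebra \<nu>)"
    and sigma_finite: "sigma_finite_measure \<nu>"
    and rev: "reversible \<nu> m"
begin

abbreviation "\<mu> \<equiv> rw_prod \<nu> m"

lemma kernel_subprob [measurable]: "m \<in> measurable \<nu> (subprob_algebra \<nu>)"
  using kernel by (rule measurable_prob_algebraD)

lemma prob_space_kernel: "x \<in> space \<nu> \<Longrightarrow> prob_space (m x)"
  using measurable_space[OF kernel] by (auto simp: space_prob_algebra)

lemma sets_kernel_eq: "x \<in> space \<nu> \<Longrightarrow> sets (m x) = sets \<nu>"
  using measurable_space[OF kernel] by (auto simp: space_prob_algebra)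

lemma sets_rw_prod [simp, measurable_cong]: "sets \<mu> = sets (\<nu> \<Otimes>\<^sub>M \<nu>)"
  unfolding rw_prod_def using sets.sigma_sets_eq[of "\<nu> \<Otimes>\<^sub>M \<nu>"] sets.space_closed[of "\<nu> \<Otimes>\<^sub>M \<nu>"]
  by (simp add: space_pair_measure)

lemma space_rw_prod [simp]: "space \<mu> = space \<nu> \<times> space \<nu>"
  using sets_eq_imp_space_eq[OF sets_rw_prod] by (simp add: space_pair_measure)

lemma section_measurable:
  assumes "f \<in> borel_measurable (\<nu> \<Otimes>\<^sub>M \<nu>)" "x \<in> space \<nu>"
  shows "(\<lambda>y. f (x, y)) \<in> borel_measurable (m x)"
  using measurable_Pair2[OF assms(1), of x] assms(2)
    measurable_cong_sets[OF sets_kernel_eq[OF assms(2)] refl] by blast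

text \<open>Moves \<open>m x\<close> onto the slice over \<open>x\<close>; integrating these slices
  against \<open>\<nu>\<close> produces the walk measure.\<close>

lemma rw_prod_kernel: "(\<lambda>x. distr (m x) (\<nu> \<Otimes>\<^sub>M \<nu>) (Pair x)) \<in> measurable \<nu> (subprob_algebra (\<nu> \<Otimes>\<^sub>M \<nu>))"
  by (rule measurable_distr2[where M=\<nu>]) measurable

lemma Pair_measurable_kernel:
  assumes x: "x \<in> space \<nu>" shows "Pair x \<in> measurable (m x) (\<nu> \<Otimes>\<^sub>M \<nu>)"
  using measurable_Pair1'[OF x] measurable_cong_sets[OF sets_kernel_eq[OF x] refl] by blast

lemma kernel_integral_measurable:
  fixes f :: "'a \<times> 'a \<Rightarrow> real"
  assumes f: "f \<in> borel_measurable (\<nu> \<Otimes>\<^sub>M \<nu>)"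
  shows "(\<lambda>x. \<integral>y. f (x, y) \<partial>m x) \<in> borel_measurable \<nu>"
proof -
  have "(\<lambda>x. integral\<^sup>L (distr (m x) (\<nu> \<Otimes>\<^sub>M \<nu>) (Pair x)) f) \<in> borel_measurable \<nu>"
    by (rule measurable_compose[OF rw_prod_kernel integral_measurable_subprob_algebra[OF f]])
  then show ?thesis
    by (rule measurable_cong[THEN iffD1, rotated])
       (simp add: integral_distr[OF Pair_measurable_kernel f])
qed

lemma emeasure_Pair_distr:
  assumes x: "x \<in> space \<nu>" and C: "C \<in> sets (\<nu> \<Otimes>\<^sub>M \<nu>)"
  shows "emeasure (distr (m x) (\<nu> \<Otimes>\<^sub>M \<nu>) (Pair x)) C = emeasure (m x) {y. (x, y) \<in> C}"
proof -
  have [measurable_cong]: "sets (m x) = sets \<nu>" using sets_kernel_eq[OF x] .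
  have "Pair x -` C \<inter> space (m x) = {y. (x, y) \<in> C}"
    using sets.sets_into_space[OF C] sets_eq_imp_space_eq[OF sets_kernel_eq[OF x]]
    by (auto simp: space_pair_measure)
  moreover have "Pair x \<in> measurable (m x) (\<nu> \<Otimes>\<^sub>M \<nu>)" by (rule Pair_measurable_kernel[OF x])
  ultimately show ?thesis using C by (simp only: emeasure_distr)
qed

text \<open>\<open>rw_prod\<close> is built from a bare set function; identifying it with a bind
  shows that this function is a measure and brings in the integration formula. \<open>bind\<close>
  takes a default value on an empty space, so \<open>nn_integral_rw_prod\<close> treats that case
  apart.\<close>

lemma rw_prod_eq_bind:
  assumes ne: "space \<nu> \<noteq> {}"
  shows "\<mu> = \<nu> \<bind> (\<lambda>x. distr (m x) (\<nu> \<Otimes>\<^sub>M \<nu>) (Pair x))" (is "_ = ?B")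
proof -
  have sB: "sets ?B = sets (\<nu> \<Otimes>\<^sub>M \<nu>)" "space ?B = space \<nu> \<times> space \<nu>"
    using sets_bind_measurable[OF rw_prod_kernel ne] space_bind_measurable[OF rw_prod_kernel ne]
    by (auto simp: space_pair_measure)
  have "\<mu> = measure_of (space ?B) (sets ?B) (emeasure ?B)"
    unfolding rw_prod_def sB
  proof (rule measure_of_eq)
    show "sets (\<nu> \<Otimes>\<^sub>M \<nu>) \<subseteq> Pow (space \<nu> \<times> space \<nu>)"
      using sets.space_closed[of "\<nu> \<Otimes>\<^sub>M \<nu>"] by (simp add: space_pair_measure)
    fix C assume "C \<in> sigma_sets (space \<nu> \<times> space \<nu>) (sets (\<nu> \<Otimes>\<^sub>M \<nu>))"
    then have C: "C \<in> sets (\<nu> \<Otimes>\<^sub>M \<nu>)"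
      using sets.sigma_sets_eq[of "\<nu> \<Otimes>\<^sub>M \<nu>"] by (simp add: space_pair_measure)
    show "(\<integral>\<^sup>+x. emeasure (m x) {y. (x, y) \<in> C} \<partial>\<nu>) = emeasure ?B C"
      by (subst emeasure_bind[OF ne rw_prod_kernel C])
         (auto intro!: nn_integral_cong simp: emeasure_Pair_distr[OF _ C])
  qed
  then show ?thesis by (simp add: measure_of_of_measure)
qed

text \<open>Tonelli's theorem for \<open>\<mu>\<close>, inherited from the integration formula for
  \<open>bind\<close>.\<close>

lemma nn_integral_rw_prod:
  assumes [measurable]: "f \<in> borel_measurable (\<nu> \<Otimes>\<^sub>M \<nu>)"
  shows "(\<integral>\<^sup>+z. f z \<partial>\<mu>) = (\<integral>\<^sup>+x. \<integral>\<^sup>+y. f (x, y) \<partial>m x \<partial>\<nu>)"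
proof (cases "space \<nu> = {}")
  case True
  then show ?thesis by (simp add: nn_integral_empty)
next
  case False
  have "(\<integral>\<^sup>+z. f z \<partial>\<mu>) = (\<integral>\<^sup>+x. \<integral>\<^sup>+z. f z \<partial>distr (m x) (\<nu> \<Otimes>\<^sub>M \<nu>) (Pair x) \<partial>\<nu>)"
    unfolding rw_prod_eq_bind[OF False] by (rule nn_integral_bind[OF _ rw_prod_kernel]) measurable
  also have "\<dots> = (\<integral>\<^sup>+x. \<integral>\<^sup>+y. f (x, y) \<partial>m x \<partial>\<nu>)"
  proof (rule nn_integral_cong)
    fix x assume x: "x \<in> space \<nu>"
    have [measurable_cong]: "sets (m x) = sets \<nu>" using sets_kernel_eq[OF x] .
    show "(\<integral>\<^sup>+z. f z \<partial>distr (m x) (\<nu> \<Otimes>\<^sub>M \<nu>) (Pair x)) = (\<integral>\<^sup>+y. f (x, y) \<partial>m x)"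
      using x by (subst nn_integral_distr) auto
  qed
  finally show ?thesis .
qed

lemma emeasure_rw_prod:
  assumes C: "C \<in> sets (\<nu> \<Otimes>\<^sub>M \<nu>)"
  shows "emeasure \<mu> C = (\<integral>\<^sup>+x. emeasure (m x) {y. (x, y) \<in> C} \<partial>\<nu>)"
proof -
  have "emeasure \<mu> C = (\<integral>\<^sup>+z. indicator C z \<partial>\<mu>)" using C by simp
  also have "\<dots> = (\<integral>\<^sup>+x. \<integral>\<^sup>+y. indicator C (x, y) \<partial>m x \<partial>\<nu>)"
    using C by (intro nn_integral_rw_prod borel_measurable_indicator)
  also have "\<dots> = (\<integral>\<^sup>+x. emeasure (m x) {y. (x, y) \<in> C} \<partial>\<nu>)"
  proof (rule nn_integral_cong)
    fix x assume x: "x \<in> space \<nu>"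
    have "{y. (x, y) \<in> C} = Pair x -` C" by auto
    then have "{y. (x, y) \<in> C} \<in> sets (m x)" using C sets_kernel_eq[OF x] by (simp add: sets_Pair1)
    moreover have "(\<lambda>y. indicator C (x, y) :: ennreal) = indicator {y. (x, y) \<in> C}" by (auto simp: indicator_def)
    ultimately show "(\<integral>\<^sup>+y. indicator C (x, y) \<partial>m x) = emeasure (m x) {y. (x, y) \<in> C}"
      by (simp only: nn_integral_indicator)
  qed
  finally show ?thesis .
qed

section \<open>Mirror symmetry, marginals and Fubini's theorem for the walk measure\<close>

lemma swap_measurable [measurable]: "prod.swap \<in> measurable (\<nu> \<Otimes>\<^sub>M \<nu>) (\<nu> \<Otimes>\<^sub>M \<nu>)"
  unfolding prod.swap_def by measurable

text \<open>Reversibility equates the measures of a set and of its mirror image. Below it is used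
  only in this form, as a change of variables.\<close>

lemma distr_swap: "distr \<mu> (\<nu> \<Otimes>\<^sub>M \<nu>) prod.swap = \<mu>"
proof (rule measure_eqI)
  fix C assume "C \<in> sets (distr \<mu> (\<nu> \<Otimes>\<^sub>M \<nu>) prod.swap)"
  then have C[measurable]: "C \<in> sets (\<nu> \<Otimes>\<^sub>M \<nu>)" by simp
  let ?D = "prod.swap -` C \<inter> space \<mu>"
  have D: "?D \<in> sets (\<nu> \<Otimes>\<^sub>M \<nu>)" using measurable_sets[OF swap_measurable C] by (simp add: space_pair_measure)
  have "{y. (x, y) \<in> ?D} = {y. (y, x) \<in> C}" for x
    using sets.sets_into_space[OF C] by (auto simp: space_pair_measure)
  then have "emeasure \<mu> ?D = emeasure \<mu> C"
    using rev C unfolding emeasure_rw_prod[OF D] emeasure_rw_prod[OF C] reversible_def by simp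
  then show "emeasure (distr \<mu> (\<nu> \<Otimes>\<^sub>M \<nu>) prod.swap) C = emeasure \<mu> C"
    by (subst emeasure_distr) auto
qed simp

lemma integral_swap:
  fixes f :: "'a \<times> 'a \<Rightarrow> real"
  assumes [measurable]: "f \<in> borel_measurable (\<nu> \<Otimes>\<^sub>M \<nu>)"
  shows "(\<integral>z. f (prod.swap z) \<partial>\<mu>) = (\<integral>z. f z \<partial>\<mu>)"
  by (subst (2) distr_swap[symmetric], subst integral_distr) auto

lemma integrable_swap:
  fixes f :: "'a \<times> 'a \<Rightarrow> real"
  assumes "integrable \<mu> f"
  shows "integrable \<mu> (\<lambda>z. f (prod.swap z))"
proof -
  have "f \<in> borel_measurable (\<nu> \<Otimes>\<^sub>M \<nu>)" using borel_measurable_integrable[OF assms] by simp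
  then show ?thesis using assms by (subst (asm) distr_swap[symmetric], subst (asm) integrable_distr_eq) auto
qed

text \<open>The first marginal of \<open>\<mu>\<close> is \<open>\<nu>\<close>, because every
  \<open>m x\<close> has mass 1.\<close>

lemma integrable_fst_rw:
  fixes w :: "'a \<Rightarrow> real"
  assumes w: "integrable \<nu> w"
  shows "integrable \<mu> (\<lambda>z. w (fst z))"
proof -
  have [measurable]: "w \<in> borel_measurable \<nu>" using w by simp
  have "(\<integral>\<^sup>+z. ennreal (norm (w (fst z))) \<partial>\<mu>) = (\<integral>\<^sup>+x. \<integral>\<^sup>+y. ennreal (norm (w x)) \<partial>m x \<partial>\<nu>)"
    by (subst nn_integral_rw_prod) auto
  also have "\<dots> = (\<integral>\<^sup>+x. ennreal (norm (w x)) \<partial>\<nu>)"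
    by (intro nn_integral_cong) (simp add: prob_space.emeasure_space_1[OF prob_space_kernel])
  finally show ?thesis using w unfolding integrable_iff_bounded by simp
qed

text \<open>By the mirror symmetry the second marginal is \<open>\<nu>\<close> too.\<close>

lemma integrable_gradient:
  fixes w :: "'a \<Rightarrow> real"
  assumes "integrable \<nu> w"
  shows "integrable \<mu> (\<lambda>z. w (snd z) - w (fst z))"
  using integrable_fst_rw[OF assms] integrable_swap[OF integrable_fst_rw[OF assms]] by simp

text \<open>The strips \<open>B i \<times> space \<nu>\<close> have the measure of
  \<open>B i\<close>. This prepares the duality of \<open>L\<^sup>1\<close>.\<close>

lemma sigma_finite_rw_prod: "sigma_finite_measure \<mu>"
proof -
  interpret sigma_finite_measure \<nu> by (rule sigma_finite)
  obtain B :: "nat \<Rightarrow> 'a set" where B: "range B \<subseteq> sets \<nu>" "(\<Union>i. B i) = space \<nu>"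
    "\<And>i. emeasure \<nu> (B i) \<noteq> \<infinity>" using sigma_finite by blast
  have [measurable]: "B i \<in> sets \<nu>" for i using B(1) by auto
  show ?thesis
  proof (rule sigma_finite_measure.intro, rule exI[of _ "range (\<lambda>i. B i \<times> space \<nu>)"], intro conjI ballI)
    show "\<Union> (range (\<lambda>i. B i \<times> space \<nu>)) = space \<mu>" using B(2) by auto
    fix C assume "C \<in> range (\<lambda>i. B i \<times> space \<nu>)"
    then obtain i where C: "C = B i \<times> space \<nu>" by auto
    have "emeasure \<mu> C = (\<integral>\<^sup>+x. indicator (B i) x \<partial>\<nu>)"
      unfolding C
      by (subst emeasure_rw_prod, simp, intro nn_integral_cong)
         (auto split: split_indicator simp: prob_space.emeasure_space_1[OF prob_space_kernel]
            sets_eq_imp_space_eq[OF sets_kernel_eq, symmetric])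
    then show "emeasure \<mu> C \<noteq> \<infinity>" using B(3)[of i] by simp
  qed auto
qed

text \<open>Fubini's theorem, from Tonelli's by splitting \<open>f\<close> into positive and
  negative parts. Their inner integrals \<open>P\<close> and \<open>N\<close> are finite only almost
  everywhere, hence the detour through \<open>enn2real\<close>.\<close>

lemma integral_rw_prod:
  fixes f :: "'a \<times> 'a \<Rightarrow> real"
  assumes f: "integrable \<mu> f"
  shows "(\<integral>z. f z \<partial>\<mu>) = (\<integral>x. \<integral>y. f (x, y) \<partial>m x \<partial>\<nu>)"
proof -
  have [measurable]: "f \<in> borel_measurable (\<nu> \<Otimes>\<^sub>M \<nu>)" using borel_measurable_integrable[OF f] by simp
  define P where "P x = (\<integral>\<^sup>+y. ennreal (f (x, y)) \<partial>m x)" for x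
  define N where "N x = (\<integral>\<^sup>+y. ennreal (- f (x, y)) \<partial>m x)" for x
  have [measurable]: "P \<in> borel_measurable \<nu>" "N \<in> borel_measurable \<nu>"
    unfolding P_def N_def by (rule nn_integral_measurable_subprob_algebra2[where N=\<nu>]; measurable)+
  have eq: "(\<integral>\<^sup>+z. ennreal (f z) \<partial>\<mu>) = (\<integral>\<^sup>+x. P x \<partial>\<nu>)" "(\<integral>\<^sup>+z. ennreal (- f z) \<partial>\<mu>) = (\<integral>\<^sup>+x. N x \<partial>\<nu>)"
    unfolding P_def N_def by (rule nn_integral_rw_prod; measurable)+
  have "(\<integral>\<^sup>+z. ennreal (f z) \<partial>\<mu>) \<noteq> \<infinity>" "(\<integral>\<^sup>+z. ennreal (- f z) \<partial>\<mu>) \<noteq> \<infinity>"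
    using f unfolding real_integrable_def by auto
  then have fin: "(\<integral>\<^sup>+x. P x \<partial>\<nu>) \<noteq> \<infinity>" "(\<integral>\<^sup>+x. N x \<partial>\<nu>) \<noteq> \<infinity>"
    unfolding eq by auto
  have AE_fin: "AE x in \<nu>. P x \<noteq> \<infinity>" "AE x in \<nu>. N x \<noteq> \<infinity>"
    using fin by (auto intro: nn_integral_PInf_AE simp del: infinity_ennreal_def)
  have real: "integrable \<nu> (\<lambda>x. enn2real (Q x)) \<and> (\<integral>x. enn2real (Q x) \<partial>\<nu>) = enn2real (\<integral>\<^sup>+x. Q x \<partial>\<nu>)"
    if [measurable]: "Q \<in> borel_measurable \<nu>" and Q: "(\<integral>\<^sup>+x. Q x \<partial>\<nu>) \<noteq> \<infinity>" "AE x in \<nu>. Q x \<noteq> \<infinity>" for Q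
  proof -
    have *: "(\<integral>\<^sup>+x. ennreal (enn2real (Q x)) \<partial>\<nu>) = (\<integral>\<^sup>+x. Q x \<partial>\<nu>)"
      using Q(2) by (intro nn_integral_cong_AE) (auto elim!: eventually_mono simp: less_top)
    show ?thesis
      using Q(1) * by (auto intro!: integrableI_nonneg simp: less_top[symmetric] integral_eq_nn_integral)
  qed
  have "(\<integral>x. \<integral>y. f (x, y) \<partial>m x \<partial>\<nu>) = (\<integral>x. enn2real (P x) - enn2real (N x) \<partial>\<nu>)"
  proof (rule integral_cong_AE)
    show "(\<lambda>x. \<integral>y. f (x, y) \<partial>m x) \<in> borel_measurable \<nu>"
      by (rule kernel_integral_measurable) measurable
    show "AE x in \<nu>. (\<integral>y. f (x, y) \<partial>m x) = enn2real (P x) - enn2real (N x)"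
      using AE_fin AE_space
    proof eventually_elim
      case (elim x)
      then have "integrable (m x) (\<lambda>y. f (x, y))"
        unfolding real_integrable_def P_def N_def using section_measurable[of f x] by auto
      then show ?case unfolding P_def N_def by (rule real_lebesgue_integral_def)
    qed
  qed measurable
  also have "\<dots> = enn2real (\<integral>\<^sup>+x. P x \<partial>\<nu>) - enn2real (\<integral>\<^sup>+x. N x \<partial>\<nu>)"
    using real[of P] real[of N] fin AE_fin by simp
  also have "\<dots> = (\<integral>z. f z \<partial>\<mu>)"
    unfolding eq[symmetric] by (rule real_lebesgue_integral_def[OF f, symmetric])
  finally show ?thesis by simp
qed

end

section \<open>The weighted total variation energy\<close>

text \<open>Isolates the properties of \<open>K_A\<close> on which the energy argument
  rests.\<close>

locale weighted_walk = reversible_walk \<nu> m for \<nu> :: "'a measure" and m :: "'a \<Rightarrow> 'a measure" +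
  fixes K :: "'a \<times> 'a \<Rightarrow> real"
  assumes K_measurable [measurable]: "K \<in> borel_measurable (\<nu> \<Otimes>\<^sub>M \<nu>)"
    and K_nonneg: "0 \<le> K z" and K_le_1: "K z \<le> 1"
    and K_swap: "K (prod.swap z) = K z"
begin

definition grad :: "('a \<Rightarrow> real) \<Rightarrow> 'a \<times> 'a \<Rightarrow> real" where
  "grad w z = w (snd z) - w (fst z)"

text \<open>For antisymmetric \<open>g\<close> this is the nonlocal divergence of
  \<open>g * K\<close>.\<close>

definition flux :: "('a \<times> 'a \<Rightarrow> real) \<Rightarrow> 'a \<Rightarrow> real" where
  "flux g x = (\<integral>y. g (x, y) * K (x, y) \<partial>m x)"

definition energy :: "('a \<Rightarrow> real) \<Rightarrow> ennreal" where
  "energy w = ennreal (1/2) * (\<integral>\<^sup>+z. ennreal (\<bar>grad w z\<bar> * K z) \<partial>\<mu>)"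

lemma grad_measurable [measurable]:
  assumes [measurable]: "w \<in> borel_measurable \<nu>"
  shows "grad w \<in> borel_measurable (\<nu> \<Otimes>\<^sub>M \<nu>)"
  unfolding grad_def by measurable

lemma grad_swap: "grad w (prod.swap z) = - grad w z"
  unfolding grad_def by simp

lemma integrable_grad_weight:
  assumes "integrable \<nu> w" shows "integrable \<mu> (\<lambda>z. \<bar>grad w z\<bar> * K z)"
proof (rule Bochner_Integration.integrable_bound[OF integrable_gradient[OF assms]])
  have [measurable]: "w \<in> borel_measurable \<nu>" using assms by simp
  show "(\<lambda>z. \<bar>grad w z\<bar> * K z) \<in> borel_measurable \<mu>" by measurable
  show "AE z in \<mu>. norm (\<bar>grad w z\<bar> * K z) \<le> norm (w (snd z) - w (fst z))"
    by (intro AE_I2) (auto simp: grad_def abs_mult K_nonneg intro!: mult_right_le_one_le K_le_1)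
qed

lemma energy_eq:
  assumes "integrable \<mu> (\<lambda>z. \<bar>grad w z\<bar> * K z)"
  shows "energy w = ennreal ((\<integral>z. \<bar>grad w z\<bar> * K z \<partial>\<mu>) / 2)"
proof -
  have "energy w = ennreal (1/2) * ennreal (\<integral>z. \<bar>grad w z\<bar> * K z \<partial>\<mu>)"
    unfolding energy_def using assms by (subst nn_integral_eq_integral) (auto simp: K_nonneg)
  also have "\<dots> = ennreal (1/2 * (\<integral>z. \<bar>grad w z\<bar> * K z \<partial>\<mu>))"
    by (rule ennreal_mult[symmetric]) (auto intro!: Bochner_Integration.integral_nonneg simp: K_nonneg)
  finally show ?thesis by simp
qed

lemma energy_finite_integrable:
  assumes [measurable]: "w \<in> borel_measurable \<nu>" and "energy w < \<infinity>"
  shows "integrable \<mu> (\<lambda>z. \<bar>grad w z\<bar> * K z)"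
proof (rule integrableI_nonneg)
  show "(\<lambda>z. \<bar>grad w z\<bar> * K z) \<in> borel_measurable \<mu>" by measurable
  show "AE z in \<mu>. 0 \<le> \<bar>grad w z\<bar> * K z" by (simp add: K_nonneg)
  show "(\<integral>\<^sup>+z. ennreal (\<bar>grad w z\<bar> * K z) \<partial>\<mu>) < \<infinity>"
    using assms(2) unfolding energy_def by (auto simp: ennreal_mult_less_top)
qed

lemma energy_add:
  assumes [measurable]: "w \<in> borel_measurable \<nu>" "w' \<in> borel_measurable \<nu>"
  shows "energy (\<lambda>x. w x + w' x) \<le> energy w + energy w'"
proof -
  have "(\<integral>\<^sup>+z. ennreal (\<bar>grad (\<lambda>x. w x + w' x) z\<bar> * K z) \<partial>\<mu>)
      \<le> (\<integral>\<^sup>+z. ennreal (\<bar>grad w z\<bar> * K z) + ennreal (\<bar>grad w' z\<bar> * K z) \<partial>\<mu>)"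
  proof (rule nn_integral_mono)
    fix z
    have "\<bar>grad (\<lambda>x. w x + w' x) z\<bar> * K z \<le> (\<bar>grad w z\<bar> + \<bar>grad w' z\<bar>) * K z"
      unfolding grad_def by (intro mult_right_mono K_nonneg) auto
    then show "ennreal (\<bar>grad (\<lambda>x. w x + w' x) z\<bar> * K z) \<le> ennreal (\<bar>grad w z\<bar> * K z) + ennreal (\<bar>grad w' z\<bar> * K z)"
      by (subst ennreal_plus[symmetric]) (auto simp: K_nonneg distrib_right simp del: ennreal_plus intro!: ennreal_leI)
  qed
  also have "\<dots> = (\<integral>\<^sup>+z. ennreal (\<bar>grad w z\<bar> * K z) \<partial>\<mu>) + (\<integral>\<^sup>+z. ennreal (\<bar>grad w' z\<bar> * K z) \<partial>\<mu>)"
    by (rule nn_integral_add) measurable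
  finally show ?thesis unfolding energy_def distrib_left[symmetric] by (rule mult_left_mono) simp
qed

section \<open>Integration by parts\<close>

lemma flux_measurable [measurable]:
  assumes [measurable]: "g \<in> borel_measurable (\<nu> \<Otimes>\<^sub>M \<nu>)"
  shows "flux g \<in> borel_measurable \<nu>"
  unfolding flux_def by (rule kernel_integral_measurable) measurable

lemma integrable_grad_mult:
  assumes "integrable \<mu> (\<lambda>z. \<bar>grad w z\<bar> * K z)" and w[measurable]: "w \<in> borel_measurable \<nu>"
    and [measurable]: "g \<in> borel_measurable (\<nu> \<Otimes>\<^sub>M \<nu>)" and g: "AE z in \<mu>. \<bar>g z\<bar> \<le> 1"
  shows "integrable \<mu> (\<lambda>z. g z * grad w z * K z)"
proof (rule Bochner_Integration.integrable_bound[OF assms(1)])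
  show "(\<lambda>z. g z * grad w z * K z) \<in> borel_measurable \<mu>" by measurable
  show "AE z in \<mu>. norm (g z * grad w z * K z) \<le> norm (\<bar>grad w z\<bar> * K z)"
    using g by eventually_elim (auto simp: abs_mult mult.assoc K_nonneg intro!: mult_left_le_one_le)
qed

text \<open>Splitting \<open>grad w\<close> gives two terms, and swapping the variables turns the
  one with \<open>w (snd z)\<close> into the other. Integrability of \<open>w\<close> makes each
  term integrable on its own.\<close>

lemma integral_grad_flux:
  assumes w: "integrable \<nu> w"
    and [measurable]: "g \<in> borel_measurable (\<nu> \<Otimes>\<^sub>M \<nu>)" and g: "AE z in \<mu>. \<bar>g z\<bar> \<le> 1"
    and anti: "AE z in \<mu>. g z = - g (prod.swap z)"
  shows "(\<integral>z. g z * grad w z * K z \<partial>\<mu>) = - 2 * (\<integral>x. w x * flux g x \<partial>\<nu>)"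
proof -
  have [measurable]: "w \<in> borel_measurable \<nu>" using w by simp
  define \<phi> where "\<phi> z = w (fst z) * (g z * K z)" for z
  have [measurable]: "\<phi> \<in> borel_measurable (\<nu> \<Otimes>\<^sub>M \<nu>)" unfolding \<phi>_def by measurable
  have i: "integrable \<mu> \<phi>"
  proof (rule Bochner_Integration.integrable_bound[OF integrable_fst_rw[OF w]])
    show "AE z in \<mu>. norm (\<phi> z) \<le> norm (w (fst z))"
      using g
    proof eventually_elim
      case (elim z)
      then have "\<bar>g z\<bar> * \<bar>K z\<bar> \<le> 1 * 1" using K_nonneg[of z] K_le_1[of z] by (intro mult_mono) auto
      then show ?case unfolding \<phi>_def by (auto simp: abs_mult intro!: mult_right_le_one_le)
    qed
  qed simp
  have "(\<integral>z. g z * grad w z * K z \<partial>\<mu>) = (\<integral>z. - \<phi> (prod.swap z) - \<phi> z \<partial>\<mu>)"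
  proof (rule integral_cong_AE)
    show "AE z in \<mu>. g z * grad w z * K z = - \<phi> (prod.swap z) - \<phi> z"
      using anti
    proof eventually_elim
      case (elim z)
      then have "g (prod.swap z) = - g z" by simp
      then show ?case unfolding \<phi>_def K_swap by (simp add: grad_def algebra_simps)
    qed
  qed measurable
  also have "\<dots> = - 2 * (\<integral>z. \<phi> z \<partial>\<mu>)"
    using i integrable_swap[OF i] by (simp add: integral_swap)
  also have "(\<integral>z. \<phi> z \<partial>\<mu>) = (\<integral>x. w x * flux g x \<partial>\<nu>)"
    unfolding integral_rw_prod[OF i] by (simp add: flux_def \<phi>_def)
  finally show ?thesis .
qed

text \<open>Thresholding is 1-Lipschitz, so \<open>\<bar>grad w z\<bar> * K z\<close> is a majorant,
  integrable by finiteness of the energy.\<close>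

lemma integral_grad_soft_tendsto:
  assumes w[measurable]: "w \<in> borel_measurable \<nu>" and fin: "energy w < \<infinity>"
    and [measurable]: "g \<in> borel_measurable (\<nu> \<Otimes>\<^sub>M \<nu>)" and g: "AE z in \<mu>. \<bar>g z\<bar> \<le> 1"
  shows "(\<lambda>n. \<integral>z. g z * grad (\<lambda>x. soft (1 / real (Suc n)) (w x)) z * K z \<partial>\<mu>)
           \<longlonglongrightarrow> (\<integral>z. g z * grad w z * K z \<partial>\<mu>)"
proof (rule integral_dominated_convergence[OF _ _ energy_finite_integrable[OF w fin]])
  show "(\<lambda>z. g z * grad w z * K z) \<in> borel_measurable \<mu>" by measurable
  show "(\<lambda>z. g z * grad (\<lambda>x. soft (1 / real (Suc n)) (w x)) z * K z) \<in> borel_measurable \<mu>" for n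
    by measurable
  show "AE z in \<mu>. (\<lambda>n. g z * grad (\<lambda>x. soft (1 / real (Suc n)) (w x)) z * K z)
      \<longlonglongrightarrow> g z * grad w z * K z"
    unfolding grad_def by (intro AE_I2 tendsto_intros soft_tendsto)
  show "AE z in \<mu>. norm (g z * grad (\<lambda>x. soft (1 / real (Suc n)) (w x)) z * K z) \<le> \<bar>grad w z\<bar> * K z" for n
    using g
  proof eventually_elim
    case (elim z)
    have "\<bar>g z\<bar> * \<bar>grad (\<lambda>x. soft (1 / real (Suc n)) (w x)) z\<bar> \<le> 1 * \<bar>grad w z\<bar>"
      using elim soft_lipschitz[of "1 / real (Suc n)"] by (intro mult_mono) (auto simp: grad_def)
    then show ?case using K_nonneg[of z] by (simp add: abs_mult mult_right_mono)
  qed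
qed

text \<open>Here \<open>w\<close> need not be integrable, so the two terms of \<open>grad w\<close>
  cannot be separated; the identity is established for the thresholds of \<open>w\<close> and passed
  to the limit on both sides.\<close>

lemma integral_eq_grad:
  assumes v: "L2 \<nu> v" and w: "L2 \<nu> w" and fin: "energy w < \<infinity>"
    and [measurable]: "g \<in> borel_measurable (\<nu> \<Otimes>\<^sub>M \<nu>)" and g: "AE z in \<mu>. \<bar>g z\<bar> \<le> 1"
    and anti: "AE z in \<mu>. g z = - g (prod.swap z)"
    and flux: "AE x in \<nu>. v x = - flux g x"
  shows "(\<integral>x. v x * w x \<partial>\<nu>) = (\<integral>z. g z * grad w z * K z \<partial>\<mu>) / 2"
proof -
  have [measurable]: "v \<in> borel_measurable \<nu>" "w \<in> borel_measurable \<nu>" using v w unfolding L2_def by auto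
  let ?w = "\<lambda>n x. soft (1 / real (Suc n)) (w x)"
  have "(\<integral>x. v x * ?w n x \<partial>\<nu>) = (\<integral>z. g z * grad (?w n) z * K z \<partial>\<mu>) / 2" for n
  proof -
    have "(\<integral>x. v x * ?w n x \<partial>\<nu>) = (\<integral>x. - (?w n x * flux g x) \<partial>\<nu>)"
      using flux by (intro integral_cong_AE) (auto elim!: eventually_mono)
    then show ?thesis
      using integral_grad_flux[OF integrable_soft[OF w] \<open>g \<in> _\<close> g anti, of "1 / real (Suc n)"] by simp
  qed
  then have "(\<lambda>n. \<integral>x. v x * ?w n x \<partial>\<nu>) \<longlonglongrightarrow> (\<integral>z. g z * grad w z * K z \<partial>\<mu>) / 2"
    by (simp only:) (intro tendsto_divide integral_grad_soft_tendsto[OF _ fin _ g] tendsto_const; simp)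
  then show ?thesis using integral_mult_soft_tendsto[OF v w] LIMSEQ_unique by blast
qed

section \<open>From a calibrating field to a subgradient\<close>

text \<open>The energy of \<open>u\<close> is not known to be finite, so integration by parts cannot
  be applied to \<open>u\<close> itself. The field also calibrates every threshold of
  \<open>u\<close>, which gives equality there, and Fatou's lemma passes to
  \<open>u\<close>.\<close>

lemma energy_le_if_calibrated:
  assumes v: "L2 \<nu> v" and u: "L2 \<nu> u"
    and gm[measurable]: "g \<in> borel_measurable (\<nu> \<Otimes>\<^sub>M \<nu>)" and g: "AE z in \<mu>. \<bar>g z\<bar> \<le> 1"
    and anti: "AE z in \<mu>. g z = - g (prod.swap z)"
    and flux: "AE x in \<nu>. v x = - flux g x"
    and sign: "AE z in \<mu>. \<exists>s \<in> sign_set (grad u z). g z * K z = s * K z"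
  shows "energy u \<le> ennreal (\<integral>x. v x * u x \<partial>\<nu>)"
proof -
  have [measurable]: "v \<in> borel_measurable \<nu>" "u \<in> borel_measurable \<nu>" using v u unfolding L2_def by auto
  have two_half: "2 * ennreal (1/2) = 1" "ennreal (1/2) * 2 = 1"
    using ennreal_mult[of 2 "1/2"] ennreal_mult[of "1/2" 2] by auto
  let ?u = "\<lambda>n x. soft (1 / real (Suc n)) (u x)"
  have eq: "energy (?u n) = ennreal (\<integral>x. v x * ?u n x \<partial>\<nu>)" for n
  proof -
    have i: "integrable \<mu> (\<lambda>z. \<bar>grad (?u n) z\<bar> * K z)"
      by (intro integrable_grad_weight integrable_soft[OF u]) simp
    have "(\<integral>z. \<bar>grad (?u n) z\<bar> * K z \<partial>\<mu>) = (\<integral>z. g z * grad (?u n) z * K z \<partial>\<mu>)"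
    proof (rule integral_cong_AE)
      show "AE z in \<mu>. \<bar>grad (?u n) z\<bar> * K z = g z * grad (?u n) z * K z"
        using sign
      proof eventually_elim
        case (elim z)
        then obtain s where s: "s \<in> sign_set (grad u z)" "g z * K z = s * K z" by blast
        \<comment> \<open>Where \<open>u\<close> has a nonzero difference, \<open>s\<close> is its
          sign and monotonicity does not reverse it; where the difference is 0, so is that of the
          thresholds.\<close>
        have "s * grad (?u n) z = \<bar>grad (?u n) z\<bar>"
          using s(1) soft_mono[of "1 / real (Suc n)" "u (fst z)" "u (snd z)"]
            soft_mono[of "1 / real (Suc n)" "u (snd z)" "u (fst z)"]
          unfolding sign_set_def grad_def by (auto split: if_splits)
        then have "\<bar>grad (?u n) z\<bar> * K z = grad (?u n) z * (s * K z)" by (simp add: ac_simps)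
        then show ?case unfolding s(2)[symmetric] by (simp add: ac_simps)
      qed
    qed measurable
    also have "\<dots> / 2 = (\<integral>x. v x * ?u n x \<partial>\<nu>)"
      using energy_eq[OF i] by (intro integral_eq_grad[OF v _ _ gm g anti flux, symmetric] L2_soft[OF u]) auto
    finally show ?thesis using energy_eq[OF i] by simp
  qed
  have "(\<integral>\<^sup>+z. ennreal (\<bar>grad u z\<bar> * K z) \<partial>\<mu>)
      = (\<integral>\<^sup>+z. liminf (\<lambda>n. ennreal (\<bar>grad (?u n) z\<bar> * K z)) \<partial>\<mu>)"
  proof (rule nn_integral_cong)
    fix z
    have "(\<lambda>n. ennreal (\<bar>grad (?u n) z\<bar> * K z)) \<longlonglongrightarrow> ennreal (\<bar>grad u z\<bar> * K z)"
      unfolding grad_def by (intro tendsto_ennrealI tendsto_intros soft_tendsto)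
    then show "ennreal (\<bar>grad u z\<bar> * K z) = liminf (\<lambda>n. ennreal (\<bar>grad (?u n) z\<bar> * K z))"
      using lim_imp_Liminf[OF sequentially_bot] by metis
  qed
  also have "\<dots> \<le> liminf (\<lambda>n. \<integral>\<^sup>+z. ennreal (\<bar>grad (?u n) z\<bar> * K z) \<partial>\<mu>)"
    by (rule nn_integral_liminf) measurable
  also have "(\<lambda>n. \<integral>\<^sup>+z. ennreal (\<bar>grad (?u n) z\<bar> * K z) \<partial>\<mu>) = (\<lambda>n. 2 * energy (?u n))"
    unfolding energy_def by (simp only: mult.assoc[symmetric] two_half mult_1)
  also have "liminf \<dots> = 2 * ennreal (\<integral>x. v x * u x \<partial>\<nu>)"
  proof (rule lim_imp_Liminf[OF sequentially_bot])
    show "(\<lambda>n. 2 * energy (?u n)) \<longlonglongrightarrow> 2 * ennreal (\<integral>x. v x * u x \<partial>\<nu>)"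
      unfolding eq by (intro ennreal_tendsto_cmult tendsto_ennrealI integral_mult_soft_tendsto[OF v u]) simp
  qed
  finally have "energy u \<le> ennreal (1/2) * (2 * ennreal (\<integral>x. v x * u x \<partial>\<nu>))"
    unfolding energy_def by (rule mult_left_mono) simp
  also have "\<dots> = ennreal (\<integral>x. v x * u x \<partial>\<nu>)"
    by (simp only: mult.assoc[symmetric] two_half mult_1)
  finally show ?thesis .
qed

lemma subdiff_if_calibrated:
  assumes v: "L2 \<nu> v" and u: "L2 \<nu> u"
    and gm: "g \<in> borel_measurable (\<nu> \<Otimes>\<^sub>M \<nu>)" and g: "AE z in \<mu>. \<bar>g z\<bar> \<le> 1"
    and anti: "AE z in \<mu>. g z = - g (prod.swap z)"
    and flux: "AE x in \<nu>. v x = - flux g x"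
    and sign: "AE z in \<mu>. \<exists>s \<in> sign_set (grad u z). g z * K z = s * K z"
  shows "v \<in> subdiff_L2 \<nu> energy u"
  unfolding subdiff_L2_def
proof (intro CollectI conjI allI impI v)
  note gm [measurable]
  have [measurable]: "v \<in> borel_measurable \<nu>" "u \<in> borel_measurable \<nu>" using v u unfolding L2_def by auto
  have le: "energy u \<le> ennreal (\<integral>x. v x * u x \<partial>\<nu>)"
    by (rule energy_le_if_calibrated[OF v u gm g anti flux sign])
  then show fin: "energy u < \<infinity>" by (auto intro: order.strict_trans1[OF _ ennreal_less_top])
  have iu: "integrable \<mu> (\<lambda>z. \<bar>grad u z\<bar> * K z)" by (rule energy_finite_integrable[OF _ fin]) simp
  define r where "r = (\<integral>z. \<bar>grad u z\<bar> * K z \<partial>\<mu>) / 2"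
  have r0: "0 \<le> r" unfolding r_def by (auto intro!: Bochner_Integration.integral_nonneg simp: K_nonneg)
  have er: "energy u = ennreal r" using energy_eq[OF iu] unfolding r_def .
  have dual: "(\<integral>x. v x * w x \<partial>\<nu>) \<le> (\<integral>z. \<bar>grad w z\<bar> * K z \<partial>\<mu>) / 2"
    if w: "L2 \<nu> w" and wf: "energy w < \<infinity>" for w
  proof -
    have wm[measurable]: "w \<in> borel_measurable \<nu>" using w unfolding L2_def by simp
    note iw = energy_finite_integrable[OF wm wf]
    have "(\<integral>z. g z * grad w z * K z \<partial>\<mu>) \<le> (\<integral>z. \<bar>grad w z\<bar> * K z \<partial>\<mu>)"
    proof (rule integral_mono_AE[OF integrable_grad_mult[OF iw wm gm g] iw])
      show "AE z in \<mu>. g z * grad w z * K z \<le> \<bar>grad w z\<bar> * K z"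
        using g
      proof eventually_elim
        case (elim z)
        have "g z * grad w z \<le> \<bar>g z\<bar> * \<bar>grad w z\<bar>" using abs_ge_self[of "g z * grad w z"] by (simp add: abs_mult)
        also have "\<dots> \<le> \<bar>grad w z\<bar>" using elim by (intro mult_left_le_one_le) auto
        finally show ?case by (intro mult_right_mono K_nonneg)
      qed
    qed
    then show ?thesis using integral_eq_grad[OF v w wf gm g anti flux] by simp
  qed
  \<comment> \<open>\<open>ennreal\<close> sends negative numbers to 0, so \<open>le\<close> alone
    does not give a real inequality. If the integral were negative, the energy would be 0,
    \<open>grad u * K\<close> would vanish almost everywhere, and integration by parts would make
    the integral 0.\<close>
  have ru: "r \<le> (\<integral>x. v x * u x \<partial>\<nu>)"
  proof (cases "0 \<le> (\<integral>x. v x * u x \<partial>\<nu>)")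
    case True then show ?thesis using le r0 unfolding er by (simp add: ennreal_le_iff)
  next
    case False
    then have "r = 0" using le r0 unfolding er by (simp add: ennreal_neg)
    have "AE z in \<mu>. \<bar>grad u z\<bar> * K z = 0"
      using integral_nonneg_eq_0_iff_AE[OF iu] \<open>r = 0\<close> unfolding r_def by (simp add: K_nonneg)
    then have "AE z in \<mu>. g z * grad u z * K z = 0" by eventually_elim auto
    then have "(\<integral>z. g z * grad u z * K z \<partial>\<mu>) = 0" by (rule integral_eq_zero_AE)
    then show ?thesis using integral_eq_grad[OF v u fin gm g anti flux] \<open>r = 0\<close> by simp
  qed
  fix w assume w: "L2 \<nu> w"
  show "enn2ereal (energy u) + ereal (\<integral>x. v x * (w x - u x) \<partial>\<nu>) \<le> enn2ereal (energy w)"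
  proof (cases "energy w < \<infinity>")
    case False
    then show ?thesis by (simp add: less_top[symmetric])
  next
    case True
    have wm: "w \<in> borel_measurable \<nu>" using w unfolding L2_def by simp
    let ?r = "(\<integral>z. \<bar>grad w z\<bar> * K z \<partial>\<mu>) / 2"
    have ew: "energy w = ennreal ?r" by (rule energy_eq[OF energy_finite_integrable[OF wm True]])
    have "0 \<le> ?r" by (auto intro!: Bochner_Integration.integral_nonneg simp: K_nonneg)
    moreover have "(\<integral>x. v x * (w x - u x) \<partial>\<nu>) = (\<integral>x. v x * w x \<partial>\<nu>) - (\<integral>x. v x * u x \<partial>\<nu>)"
      using L2_mult_integrable[OF v w] L2_mult_integrable[OF v u] by (simp add: right_diff_distrib)
    ultimately show ?thesis
      unfolding er ew using dual[OF w True] ru r0 by (simp add: enn2ereal_ennreal)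
  qed
qed

section \<open>From a subgradient to a calibrating field\<close>

text \<open>The test functions are 0 for the second claim and \<open>u + w\<close> for the third,
  where subadditivity of the energy lets the finite \<open>energy u\<close> cancel.\<close>

lemma subdiff_energyD:
  assumes v: "v \<in> subdiff_L2 \<nu> energy u" and u: "L2 \<nu> u"
  shows "energy u < \<infinity>"
    and "(\<integral>z. \<bar>grad u z\<bar> * K z \<partial>\<mu>) / 2 \<le> (\<integral>x. v x * u x \<partial>\<nu>)"
    and "\<And>w. L2 \<nu> w \<Longrightarrow> integrable \<nu> w \<Longrightarrow> (\<integral>x. v x * w x \<partial>\<nu>) \<le> (\<integral>z. \<bar>grad w z\<bar> * K z \<partial>\<mu>) / 2"
proof -
  have um: "u \<in> borel_measurable \<nu>" using u unfolding L2_def by simp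
  show fin: "energy u < \<infinity>" using v unfolding subdiff_L2_def by simp
  have sub: "enn2ereal (energy u) + ereal (\<integral>x. v x * (w x - u x) \<partial>\<nu>) \<le> enn2ereal (energy w)"
    if "L2 \<nu> w" for w using v that unfolding subdiff_L2_def by blast
  define r where "r = (\<integral>z. \<bar>grad u z\<bar> * K z \<partial>\<mu>) / 2"
  have r0: "0 \<le> r" unfolding r_def by (auto intro!: Bochner_Integration.integral_nonneg simp: K_nonneg)
  have er: "energy u = ennreal r"
    using energy_eq[OF energy_finite_integrable[OF um fin]] unfolding r_def .
  have "energy (\<lambda>x. 0) = 0" unfolding energy_def grad_def by simp
  then show "(\<integral>z. \<bar>grad u z\<bar> * K z \<partial>\<mu>) / 2 \<le> (\<integral>x. v x * u x \<partial>\<nu>)"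
    using sub[OF L2_zero] r0 unfolding er r_def[symmetric] by (simp add: enn2ereal_ennreal zero_ennreal.rep_eq)
  fix w assume w: "L2 \<nu> w" and iw: "integrable \<nu> w"
  have wm: "w \<in> borel_measurable \<nu>" using w unfolding L2_def by simp
  let ?r = "(\<integral>z. \<bar>grad w z\<bar> * K z \<partial>\<mu>) / 2"
  have "0 \<le> ?r" by (auto intro!: Bochner_Integration.integral_nonneg simp: K_nonneg)
  have "enn2ereal (energy u) + ereal (\<integral>x. v x * w x \<partial>\<nu>) \<le> enn2ereal (energy (\<lambda>x. u x + w x))"
    using sub[OF L2_add[OF u w]] by simp
  also have "\<dots> \<le> enn2ereal (ennreal (r + ?r))"
    using energy_add[OF um wm] r0 \<open>0 \<le> ?r\<close>
    unfolding er energy_eq[OF integrable_grad_weight[OF iw]] less_eq_ennreal.rep_eq by simp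
  finally show "(\<integral>x. v x * w x \<partial>\<nu>) \<le> ?r"
    using r0 \<open>0 \<le> ?r\<close> unfolding er by (simp add: enn2ereal_ennreal del: ennreal_plus)
qed

lemma dual_field_exists:
  assumes v: "L2 \<nu> v"
    and dom: "\<And>w. L2 \<nu> w \<Longrightarrow> integrable \<nu> w \<Longrightarrow>
      (\<integral>x. v x * w x \<partial>\<nu>) \<le> (\<integral>z. \<bar>grad w z\<bar> * K z \<partial>\<mu>) / 2"
  obtains g where "g \<in> borel_measurable (\<nu> \<Otimes>\<^sub>M \<nu>)" "\<And>z. \<bar>g z\<bar> \<le> 1" "\<And>z. g z = - g (prod.swap z)"
    "\<And>w. L2 \<nu> w \<Longrightarrow> integrable \<nu> w \<Longrightarrow>
      (\<integral>x. v x * w x \<partial>\<nu>) = (\<integral>z. g z * grad w z * K z \<partial>\<mu>) / 2"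
proof -
  \<comment> \<open>With the weight moved into the measure, the energy is half the
    \<open>L\<^sup>1\<close> norm of the gradient.\<close>
  define \<kappa> where "\<kappa> = density \<mu> (\<lambda>z. ennreal (K z))"
  have sets_\<kappa>[simp, measurable_cong]: "sets \<kappa> = sets (\<nu> \<Otimes>\<^sub>M \<nu>)" unfolding \<kappa>_def by simp
  interpret mu: sigma_finite_measure \<mu> by (rule sigma_finite_rw_prod)
  interpret kappa: sigma_finite_measure \<kappa>
    unfolding \<kappa>_def by (subst mu.sigma_finite_iff_density_finite) auto
  have K: "K \<in> borel_measurable \<mu>" by measurable
  have int_\<kappa>: "(\<integral>z. f z \<partial>\<kappa>) = (\<integral>z. K z * f z \<partial>\<mu>)" if "f \<in> borel_measurable (\<nu> \<Otimes>\<^sub>M \<nu>)" for f :: "_ \<Rightarrow> real"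
    unfolding \<kappa>_def using that K_nonneg by (subst integral_density[OF _ K]) auto
  have grad_int: "integrable \<kappa> (grad w)" if "integrable \<nu> w" for w
  proof -
    have wm[measurable]: "w \<in> borel_measurable \<nu>" using that by simp
    have "integrable \<mu> (\<lambda>z. K z * grad w z)"
      using integrable_grad_mult[OF integrable_grad_weight[OF that] wm, of "\<lambda>z. 1"] by (simp add: mult.commute)
    then show ?thesis unfolding \<kappa>_def using K_nonneg by (subst integrable_density[OF _ K]) auto
  qed
  interpret E: function_subspace "{f :: _ \<Rightarrow> real. integrable \<kappa> f}"
    by standard auto
  define p where "p f = (\<integral>z. \<bar>f z\<bar> \<partial>\<kappa>) / 2" for f :: "_ \<Rightarrow> real"
  \<comment> \<open>A graph is used since the integral is not known beforehand to depend on
    \<open>w\<close> through \<open>grad w\<close> alone. Integrability of \<open>w\<close> places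
    \<open>grad w\<close> in \<open>L\<^sup>1\<close> of \<open>\<kappa>\<close>.\<close>
  define G where "G = {(grad w, \<integral>x. v x * w x \<partial>\<nu>) |w. L2 \<nu> w \<and> integrable \<nu> w}"
  have p: "sublinear_on {f. integrable \<kappa> f} p"
    unfolding sublinear_on_def
  proof (intro conjI ballI allI impI)
    fix f g :: "_ \<Rightarrow> real" assume "f \<in> {f. integrable \<kappa> f}" "g \<in> {f. integrable \<kappa> f}"
    then have fg: "integrable \<kappa> f" "integrable \<kappa> g" by auto
    have "(\<integral>z. \<bar>f z + g z\<bar> \<partial>\<kappa>) \<le> (\<integral>z. \<bar>f z\<bar> + \<bar>g z\<bar> \<partial>\<kappa>)" using fg by (intro integral_mono) auto
    then show "p (\<lambda>x. f x + g x) \<le> p f + p g" unfolding p_def using fg by simp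
  qed (simp add: p_def abs_mult)
  obtain L where L_add: "\<And>f g. integrable \<kappa> f \<Longrightarrow> integrable \<kappa> g \<Longrightarrow> L (\<lambda>x. f x + g x) = L f + L g"
    and L_scale: "\<And>f c. integrable \<kappa> f \<Longrightarrow> L (\<lambda>x. c * f x) = c * L f"
    and L_bound: "\<And>f. integrable \<kappa> f \<Longrightarrow> L f \<le> p f"
    and L_ext: "\<And>f s. (f, s) \<in> G \<Longrightarrow> L f = s"
  proof (rule E.hahn_banach_graph[OF p, of G])
    show "((\<lambda>x. 0), 0) \<in> G" unfolding G_def
      by (intro CollectI exI[of _ "\<lambda>x. 0"]) (auto simp: L2_zero grad_def fun_eq_iff)
  next
    fix f g s t assume "(f, s) \<in> G" "(g, t) \<in> G"
    then obtain w w' where w: "f = grad w" "s = (\<integral>x. v x * w x \<partial>\<nu>)" "L2 \<nu> w" "integrable \<nu> w"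
      "g = grad w'" "t = (\<integral>x. v x * w' x \<partial>\<nu>)" "L2 \<nu> w'" "integrable \<nu> w'" unfolding G_def by blast
    show "((\<lambda>x. f x + g x), s + t) \<in> G"
      unfolding G_def w using w L2_mult_integrable[OF v w(3)] L2_mult_integrable[OF v w(7)]
      by (intro CollectI exI[of _ "\<lambda>x. w x + w' x"]) (auto simp: L2_add grad_def fun_eq_iff distrib_left)
  next
    fix f s c assume "(f, s) \<in> G"
    then obtain w where w: "f = grad w" "s = (\<integral>x. v x * w x \<partial>\<nu>)" "L2 \<nu> w" "integrable \<nu> w"
      unfolding G_def by blast
    have "(\<integral>x. v x * (c * w x) \<partial>\<nu>) = c * (\<integral>x. v x * w x \<partial>\<nu>)"
      by (subst integral_mult_right_zero[symmetric]) (simp add: ac_simps)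
    then show "((\<lambda>x. c * f x), c * s) \<in> G"
      unfolding G_def w using w
      by (intro CollectI exI[of _ "\<lambda>x. c * w x"]) (auto simp: L2_scale grad_def fun_eq_iff right_diff_distrib)
  next
    fix f s assume "(f, s) \<in> G"
    then obtain w where w: "f = grad w" "s = (\<integral>x. v x * w x \<partial>\<nu>)" "L2 \<nu> w" "integrable \<nu> w"
      unfolding G_def by blast
    have [measurable]: "w \<in> borel_measurable \<nu>" using w by simp
    show "f \<in> {f. integrable \<kappa> f}" using grad_int[OF w(4)] w(1) by simp
    have "p f = (\<integral>z. \<bar>grad w z\<bar> * K z \<partial>\<mu>) / 2" unfolding p_def w by (subst int_\<kappa>) (auto simp: mult.commute)
    then show "s \<le> p f" using dom[OF w(3,4)] w(2) by simp
  qed auto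
  \<comment> \<open>\<open>p\<close> carries the factor 1/2, so \<open>2 * L\<close> is the
    functional of norm at most 1.\<close>
  obtain g0 where g0m: "g0 \<in> borel_measurable \<kappa>" and g0: "\<And>z. \<bar>g0 z\<bar> \<le> 1"
    and Lg0: "\<And>f. integrable \<kappa> f \<Longrightarrow> 2 * L f = (\<integral>z. g0 z * f z \<partial>\<kappa>)"
  proof (rule kappa.L1_dual[of "\<lambda>f. 2 * L f"])
    show "2 * L f \<le> (\<integral>z. \<bar>f z\<bar> \<partial>\<kappa>)" if "integrable \<kappa> f" for f using L_bound[OF that] unfolding p_def by simp
  qed (auto simp: L_add L_scale)
  have [measurable]: "g0 \<in> borel_measurable (\<nu> \<Otimes>\<^sub>M \<nu>)" using g0m measurable_cong_sets[OF sets_\<kappa> refl] by blast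
  \<comment> \<open>The antisymmetric part of \<open>g0\<close>. As \<open>grad w\<close> is
    antisymmetric and \<open>K\<close> symmetric, the discarded symmetric part pairs to 0 with every
    gradient considered.\<close>
  define g where "g z = (g0 z - g0 (prod.swap z)) / 2" for z
  have gm: "g \<in> borel_measurable (\<nu> \<Otimes>\<^sub>M \<nu>)" unfolding g_def by measurable
  show thesis
  proof (rule that[OF gm])
    show "\<bar>g z\<bar> \<le> 1" for z using g0[of z] g0[of "prod.swap z"] unfolding g_def by (auto simp: abs_le_iff)
    show "g z = - g (prod.swap z)" for z unfolding g_def by (simp add: field_simps)
    fix w assume w: "L2 \<nu> w" and iw: "integrable \<nu> w"
    have wm[measurable]: "w \<in> borel_measurable \<nu>" using iw by simp
    let ?f = "\<lambda>z. g0 z * grad w z * K z"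
    have i: "integrable \<mu> ?f"
      by (rule integrable_grad_mult[OF integrable_grad_weight[OF iw] wm]) (auto simp: g0)
    have "L (grad w) = (\<integral>x. v x * w x \<partial>\<nu>)" using w iw by (intro L_ext) (auto simp: G_def)
    then have "2 * (\<integral>x. v x * w x \<partial>\<nu>) = (\<integral>z. ?f z \<partial>\<mu>)"
      using Lg0[OF grad_int[OF iw]] by (subst (asm) int_\<kappa>) (auto simp: ac_simps)
    also have "\<dots> = (\<integral>z. (?f z + ?f (prod.swap z)) / 2 \<partial>\<mu>)"
      using i integrable_swap[OF i] integral_swap[of ?f] by simp
    also have "\<dots> = (\<integral>z. g z * grad w z * K z \<partial>\<mu>)"
      by (intro Bochner_Integration.integral_cong) (auto simp: g_def grad_swap K_swap field_simps)
    finally show "(\<integral>x. v x * w x \<partial>\<nu>) = (\<integral>z. g z * grad w z * K z \<partial>\<mu>) / 2" by simp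
  qed
qed

text \<open>The fundamental lemma of the calculus of variations: integration by parts makes
  \<open>v + flux g\<close> orthogonal to every \<open>w\<close> in
  \<open>L\<^sup>1 \<inter> L\<^sup>2\<close>, and this is tested on countably many sets of finite
  measure covering the space.\<close>

lemma flux_eq_if_dual:
  assumes v: "L2 \<nu> v"
    and gm[measurable]: "g \<in> borel_measurable (\<nu> \<Otimes>\<^sub>M \<nu>)" and g: "\<And>z. \<bar>g z\<bar> \<le> 1"
    and anti: "\<And>z. g z = - g (prod.swap z)"
    and dual: "\<And>w. L2 \<nu> w \<Longrightarrow> integrable \<nu> w \<Longrightarrow>
      (\<integral>x. v x * w x \<partial>\<nu>) = (\<integral>z. g z * grad w z * K z \<partial>\<mu>) / 2"
  shows "AE x in \<nu>. v x = - flux g x"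
proof -
  interpret sigma_finite_measure \<nu> by (rule sigma_finite)
  obtain B :: "nat \<Rightarrow> 'a set" where B: "range B \<subseteq> sets \<nu>" "(\<Union>i. B i) = space \<nu>"
    "\<And>i. emeasure \<nu> (B i) \<noteq> \<infinity>" using sigma_finite by blast
  have [measurable]: "B i \<in> sets \<nu>" for i using B(1) by auto
  have [measurable]: "v \<in> borel_measurable \<nu>" using v unfolding L2_def by simp
  define d where "d x = v x + flux g x" for x
  have [measurable]: "d \<in> borel_measurable \<nu>" unfolding d_def by measurable
  \<comment> \<open>An average of values in \<open>[-1, 1]\<close> against a probability measure;
    the bound makes \<open>w * flux g\<close> integrable below.\<close>
  have flux1: "\<bar>flux g x\<bar> \<le> 1" if x: "x \<in> space \<nu>" for x
  proof -
    interpret prob_space "m x" by (rule prob_space_kernel[OF x])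
    have le: "\<bar>g z * K z\<bar> \<le> 1" for z
      using mult_mono[OF g[of z] K_le_1[of z]] K_nonneg[of z] by (simp add: abs_mult)
    have "integrable (m x) (\<lambda>y. g (x, y) * K (x, y))"
      using section_measurable[of "\<lambda>z. g z * K z", OF _ x] le by (intro integrable_const_bound[of _ 1]) auto
    then have "norm (flux g x) \<le> (\<integral>y. (1 :: real) \<partial>m x)"
      unfolding flux_def using le
      by (intro order_trans[OF integral_norm_bound integral_mono]) auto
    then show ?thesis by (simp add: prob_space)
  qed
  have "AE x in \<nu>. x \<in> B i \<longrightarrow> d x = 0" for i
  proof -
    \<comment> \<open>a bounded test function with \<open>d * w \<ge> 0\<close>, vanishing on \<open>B i\<close> only where \<open>d\<close> does\<close>
    define w where "w x = indicator (B i) x * (d x / (1 + \<bar>d x\<bar>))" for x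
    have [measurable]: "w \<in> borel_measurable \<nu>" unfolding w_def by measurable
    have w1: "\<bar>w x\<bar> \<le> indicator (B i) x" for x unfolding w_def by (auto split: split_indicator simp: field_simps)
    have iB: "integrable \<nu> (indicator (B i) :: _ \<Rightarrow> real)"
      using B(3)[of i] by (simp add: integrable_indicator_iff less_top[symmetric])
    have iw: "integrable \<nu> w"
      using w1 by (intro Bochner_Integration.integrable_bound[OF iB]) (auto simp: abs_le_iff)
    have "\<bar>(w x)\<^sup>2\<bar> \<le> indicator (B i) x" for x
      using w1[of x] by (auto split: split_indicator_asm simp: abs_square_le_1)
    then have w2: "L2 \<nu> w"
      unfolding L2_def by (auto intro!: Bochner_Integration.integrable_bound[OF iB])
    have ifl: "integrable \<nu> (\<lambda>x. w x * flux g x)"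
    proof (rule Bochner_Integration.integrable_bound[OF iw])
      show "AE x in \<nu>. norm (w x * flux g x) \<le> norm (w x)"
        using flux1 by (intro AE_I2) (auto simp: abs_mult intro!: mult_right_le_one_le)
    qed measurable
    have "(\<integral>x. v x * w x \<partial>\<nu>) = - (\<integral>x. w x * flux g x \<partial>\<nu>)"
      using dual[OF w2 iw] integral_grad_flux[OF iw gm, OF AE_I2 AE_I2, OF g anti] by simp
    moreover have "(\<integral>x. d x * w x \<partial>\<nu>) = (\<integral>x. v x * w x \<partial>\<nu>) + (\<integral>x. w x * flux g x \<partial>\<nu>)"
      using L2_mult_integrable[OF v w2] ifl
      by (subst Bochner_Integration.integral_add[symmetric]) (auto simp: d_def algebra_simps)
    ultimately have "(\<integral>x. d x * w x \<partial>\<nu>) = 0" by simp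
    moreover have "integrable \<nu> (\<lambda>x. d x * w x)"
      using Bochner_Integration.integrable_add[OF L2_mult_integrable[OF v w2] ifl]
      by (simp add: d_def algebra_simps)
    moreover have "0 \<le> d x * w x" for x unfolding w_def by (auto split: split_indicator simp: zero_le_divide_iff)
    ultimately have "AE x in \<nu>. d x * w x = 0" 
      by (subst integral_nonneg_eq_0_iff_AE[symmetric]) auto
    then show ?thesis unfolding w_def by eventually_elim (auto simp: add_pos_nonneg add_nonneg_eq_0_iff)
  qed
  then have "AE x in \<nu>. \<forall>i. x \<in> B i \<longrightarrow> d x = 0" unfolding AE_all_countable by blast
  with AE_space show ?thesis
  proof eventually_elim
    case (elim x)
    then obtain i where "x \<in> B i" using B(2) by auto
    then show ?case using elim unfolding d_def by auto
  qed
qed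

theorem subdiff_energy_iff:
  assumes u: "L2 \<nu> u" and v: "L2 \<nu> v"
  shows "v \<in> subdiff_L2 \<nu> energy u \<longleftrightarrow>
    (\<exists>g. g \<in> borel_measurable (\<nu> \<Otimes>\<^sub>M \<nu>) \<and> (AE z in \<mu>. \<bar>g z\<bar> \<le> 1) \<and>
       (AE z in \<mu>. g z = - g (prod.swap z)) \<and> (AE x in \<nu>. v x = - flux g x) \<and>
       (AE z in \<mu>. \<exists>s \<in> sign_set (grad u z). g z * K z = s * K z))"
    (is "_ \<longleftrightarrow> (\<exists>g. ?P g)")
proof
  assume "\<exists>g. ?P g"
  then show "v \<in> subdiff_L2 \<nu> energy u" using subdiff_if_calibrated[OF v u] by blast
next
  assume sub: "v \<in> subdiff_L2 \<nu> energy u"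
  note D = subdiff_energyD[OF sub u]
  have um[measurable]: "u \<in> borel_measurable \<nu>" using u unfolding L2_def by simp
  obtain g where gm[measurable]: "g \<in> borel_measurable (\<nu> \<Otimes>\<^sub>M \<nu>)" and g: "\<And>z. \<bar>g z\<bar> \<le> 1"
    and anti: "\<And>z. g z = - g (prod.swap z)"
    and dual: "\<And>w. L2 \<nu> w \<Longrightarrow> integrable \<nu> w \<Longrightarrow>
      (\<integral>x. v x * w x \<partial>\<nu>) = (\<integral>z. g z * grad w z * K z \<partial>\<mu>) / 2"
    using dual_field_exists[OF v D(3)] by blast
  have flux: "AE x in \<nu>. v x = - flux g x" by (rule flux_eq_if_dual[OF v gm g anti dual])
  note iu = energy_finite_integrable[OF um D(1)]
  have ig: "integrable \<mu> (\<lambda>z. g z * grad u z * K z)"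
    by (rule integrable_grad_mult[OF iu um gm]) (simp add: g)
  \<comment> \<open>\<open>u\<close> need not be integrable, so \<open>dual\<close> does not cover
    it; finite energy lets integration by parts do so.\<close>
  have "(\<integral>x. v x * u x \<partial>\<nu>) = (\<integral>z. g z * grad u z * K z \<partial>\<mu>) / 2"
    by (rule integral_eq_grad[OF v u D(1) gm AE_I2 AE_I2 flux]) (auto simp: g intro: anti)
  then have "(\<integral>z. \<bar>grad u z\<bar> * K z - g z * grad u z * K z \<partial>\<mu>) \<le> 0"
    using D(2) iu ig by simp
  moreover have nn: "0 \<le> \<bar>grad u z\<bar> * K z - g z * grad u z * K z" for z
  proof -
    have "g z * grad u z \<le> \<bar>g z\<bar> * \<bar>grad u z\<bar>" using abs_ge_self[of "g z * grad u z"] by (simp add: abs_mult)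
    also have "\<dots> \<le> \<bar>grad u z\<bar>" using g by (intro mult_left_le_one_le) auto
    finally show ?thesis using K_nonneg[of z] by (simp add: mult_right_mono)
  qed
  ultimately have "(\<integral>z. \<bar>grad u z\<bar> * K z - g z * grad u z * K z \<partial>\<mu>) = 0"
    by (intro antisym Bochner_Integration.integral_nonneg) auto
  then have "AE z in \<mu>. \<bar>grad u z\<bar> * K z - g z * grad u z * K z = 0"
    using integral_nonneg_eq_0_iff_AE[OF Bochner_Integration.integrable_diff[OF iu ig]] nn by simp
  then have "AE z in \<mu>. \<exists>s \<in> sign_set (grad u z). g z * K z = s * K z"
  proof eventually_elim
    case (elim z)
    show ?case
    proof (cases "K z = 0")
      case True
      \<comment> \<open>Where \<open>K\<close> vanishes both products are 0, so any element of the
        sign set is a witness; \<open>sgn\<close> provides one for every difference, 0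
        included.\<close>
      moreover have "sgn (grad u z) \<in> sign_set (grad u z)" by (auto simp: sign_set_def)
      ultimately show ?thesis by auto
    next
      case False
      then have "\<bar>grad u z\<bar> = g z * grad u z" using elim by (simp flip: left_diff_distrib)
      then have "g z * grad u z = sgn (grad u z) * grad u z" by (metis abs_sgn mult.commute)
      then have "grad u z = 0 \<or> g z = sgn (grad u z)" by auto
      then have "g z \<in> sign_set (grad u z)" using g[of z] by (auto simp: sign_set_def abs_le_iff)
      then show ?thesis by blast
    qed
  qed
  moreover have "AE z in \<mu>. \<bar>g z\<bar> \<le> 1" "AE z in \<mu>. g z = - g (prod.swap z)"
    by (rule AE_I2, rule g, rule AE_I2, rule anti)
  ultimately show "\<exists>g. ?P g" using gm flux by blast
qed

end

theorem theorem4p2: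
  fixes \<nu> :: "'a measure" and m :: "'a \<Rightarrow> 'a measure" and A :: "'a \<Rightarrow> 'a set"
    and u v :: "'a \<Rightarrow> real"
  assumes rws: "random_walk_space \<nu> m"
    and rev: "reversible \<nu> m"
    and A_meas: "\<And>x. x \<in> space \<nu> \<Longrightarrow> A x \<in> sets \<nu>"
    and A_graph: "{(x, y) \<in> space \<nu> \<times> space \<nu>. y \<in> A x} \<in> sets (\<nu> \<Otimes>\<^sub>M \<nu>)"
    and u: "L2 \<nu> u" and v: "L2 \<nu> v"
  shows "v \<in> subdiff_L2 \<nu> (F_A1m A \<nu> m) u \<longleftrightarrow>
    (\<exists>g :: 'a \<times> 'a \<Rightarrow> real.
       g \<in> borel_measurable (rw_prod \<nu> m) \<and>
       (AE z in rw_prod \<nu> m. \<bar>g z\<bar> \<le> 1) \<and>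
       (AE z in rw_prod \<nu> m. g (fst z, snd z) = - g (snd z, fst z)) \<and>
       (AE x in \<nu>. v x = - (\<integral> y. g (x, y) * K_A A x y \<partial>(m x))) \<and>
       (AE z in rw_prod \<nu> m. \<exists>s \<in> sign_set (u (snd z) - u (fst z)).
           g z * K_A A (fst z) (snd z) = s * K_A A (fst z) (snd z)))"
proof -
  let ?K = "\<lambda>z. K_A A (fst z) (snd z)"
  \<comment> \<open>On the product space \<open>K_A\<close> is the mean of the indicator of
    \<open>G\<close> and that of its mirror image, which gives its joint measurability.\<close>
  define G where "G = {(x, y) \<in> space \<nu> \<times> space \<nu>. y \<in> A x}"
  have [measurable]: "G \<in> sets (\<nu> \<Otimes>\<^sub>M \<nu>)" unfolding G_def by (rule A_graph)
  interpret reversible_walk \<nu> m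
    using rws rev unfolding random_walk_space_def by (intro reversible_walk.intro) auto
  interpret weighted_walk \<nu> m ?K
  proof
    have "(\<lambda>z. (indicator G z + indicator G (prod.swap z)) / 2 :: real) \<in> borel_measurable (\<nu> \<Otimes>\<^sub>M \<nu>)"
      by measurable
    then show "?K \<in> borel_measurable (\<nu> \<Otimes>\<^sub>M \<nu>)"
      by (rule measurable_cong[THEN iffD1, rotated])
         (auto simp: K_A_def G_def space_pair_measure split: split_indicator)
    show "0 \<le> ?K z" "?K z \<le> 1" "?K (prod.swap z) = ?K z" for z
      unfolding K_A_def by (auto split: split_indicator)
  qed
  have "energy = F_A1m A \<nu> m" unfolding F_A1m_def energy_def grad_def by auto
  then show ?thesis
    using subdiff_energy_iff[OF u v] unfolding flux_def grad_def
    by (simp add: measurable_cong_sets[OF sets_rw_prod refl] prod.swap_def)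
qed

end
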